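(* Let $f:\mathbb{R}^n\to\mathbb{R}^n$ be a polynomial vector field of degree $q$ with $f(0)=0$, and let $M\subset B_r$ be a bounded nonempty region of radius $r>0$. Suppose there are $\lambda>0$ and $K\ge 1$ such that for every $x(0)\in M$ the solution of $\dot x=f(x)$ with initial condition $x(0)$ exists for all $t\ge 0$ and satisfies $$\|x(t)\|\le K\|x(0)\|e^{-\lambda t}\qquad\text{for all } t\ge 0 .$$ Let $L>0$ be a Lipschitz bound for $f$ on $B_{4Kr}$. Let $T>0$ and the integer $N$ be any such that $T<\frac{1}{2L}$ and $NT>\frac{\log (2K^2)}{2\lambda}$. Let $$c(k):=\sum_{i=0}^{N-1}\left(e^{TL}+K(TL)^k\right)^i K^2 (TL)^k ,$$ and let $k$ be any integer such that $c(k)<K$, $$c(k)^2+\frac{\log (2K^2)}{2\lambda}\,K\,\frac{(TL)^k}{T}\,(1+c(k))(K+c(k))<\frac12 ,$$ $$c(k)^2<\frac{\lambda}{KL\log (2K^2)}\left(1-(2K^2)^{-\frac{L}{\lambda}}\right).$$ Then there exist $\alpha,\beta,\gamma>0$ and a sum-of-squares polynomial $V:\mathbb{R}^n\to\mathbb{R}$, of degree at most $2q^{(Nk-1)}$, such that for all $x\in M$, $$\alpha\|x\|^2\le V(x)\le\beta\|x\|^2,\qquad \nabla V(x)^T f(x)\le-\gamma\|x\|^2 .$$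
   Context: $\|\cdot\|$ is the Euclidean norm and $B_\rho$ is the Euclidean ball of radius $\rho$ centered at $0$ in $\mathbb{R}^n$. $\log$ is the natural logarithm. A polynomial $V$ in $n$ real variables is sum-of-squares if $V=\sum_{j=1}^m p_j^2$ for finitely many real polynomials $p_j$. "$L$ is a Lipschitz bound for $f$ on $B_\rho$" means $\|f(x)-f(y)\|\le L\|x-y\|$ for all $x,y\in B_\rho$. *)

theory Defs
  imports "HOL-Analysis.Analysis"
begin

definition monomial_fun :: "('n::finite \<Rightarrow> nat) \<Rightarrow> real ^ 'n \<Rightarrow> real" where
  "monomial_fun a x = (\<Prod>i\<in>UNIV. (x $ i) ^ a i)"

definition total_degree_le :: "nat \<Rightarrow> (real ^ 'n::finite \<Rightarrow> real) \<Rightarrow> bool" where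
  "total_degree_le d p \<longleftrightarrow>
     (\<exists>c. \<forall>x. p x = (\<Sum>a | sum a UNIV \<le> d. c a * monomial_fun a x))"

text \<open>
  Polynomials in \<open>n\<close> real variables are identified with their functions on \<open>real ^ 'n\<close>; the field
  is infinite, so nothing is lost. The degrees below are meaningful for polynomial functions only
  (see \<open>real_polynomial_function_iff\<close>); the zero polynomial gets degree \<open>0\<close>.
\<close>

definition poly_fun_degree :: "(real ^ 'n::finite \<Rightarrow> real) \<Rightarrow> nat" where
  "poly_fun_degree p = (LEAST d. total_degree_le d p)"

definition vector_field_degree :: "(real ^ 'n::finite \<Rightarrow> real ^ 'm::finite) \<Rightarrow> nat" where
  "vector_field_degree f = (MAX i. poly_fun_degree (\<lambda>x. f x $ i))"

definition sum_of_squares :: "(real ^ 'n::finite \<Rightarrow> real) \<Rightarrow> bool" where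
  "sum_of_squares V \<longleftrightarrow>
     (\<exists>(m::nat) p. (\<forall>j<m. real_polynomial_function (p j)) \<and> (\<forall>x. V x = (\<Sum>j<m. (p j x)\<^sup>2)))"

definition gradient :: "('a::real_inner \<Rightarrow> real) \<Rightarrow> 'a \<Rightarrow> 'a" where
  "gradient V x = (THE D. GDERIV V x :> D)"

lemma finite_total_degree: "finite {a :: 'n::finite \<Rightarrow> nat. sum a UNIV \<le> d}"
proof (rule finite_subset)
  show "{a :: 'n \<Rightarrow> nat. sum a UNIV \<le> d} \<subseteq> PiE UNIV (\<lambda>_. {..d})"
  proof
    fix a :: "'n \<Rightarrow> nat"
    assume "a \<in> {a. sum a UNIV \<le> d}"
    moreover have "a i \<le> sum a UNIV" for i
      by (rule member_le_sum) auto
    ultimately show "a \<in> PiE UNIV (\<lambda>_. {..d})"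
      by (auto intro: order_trans)
  qed
qed (simp add: finite_PiE)

lemma total_degree_le_monomial:
  assumes "sum a UNIV \<le> d"
  shows "total_degree_le d (\<lambda>x. c * monomial_fun a x)"
  unfolding total_degree_le_def
proof (intro exI allI)
  fix x
  show "c * monomial_fun a x =
      (\<Sum>b | sum b UNIV \<le> d. (if b = a then c else 0) * monomial_fun b x)"
    using assms sum.delta[OF finite_total_degree[of d], of a "\<lambda>b. c * monomial_fun b x"]
    by (simp add: if_distrib[of "\<lambda>u. u * _"] cong: if_cong)
qed

lemma total_degree_le_add:
  assumes "total_degree_le d p" "total_degree_le d q"
  shows "total_degree_le d (\<lambda>x. p x + q x)"
proof -
  obtain c c' where "\<And>x. p x = (\<Sum>a | sum a UNIV \<le> d. c a * monomial_fun a x)"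
    "\<And>x. q x = (\<Sum>a | sum a UNIV \<le> d. c' a * monomial_fun a x)"
    using assms unfolding total_degree_le_def by blast
  then have "p x + q x = (\<Sum>a | sum a UNIV \<le> d. (c a + c' a) * monomial_fun a x)" for x
    by (simp add: sum.distrib distrib_right)
  then show ?thesis
    unfolding total_degree_le_def by (intro exI[of _ "\<lambda>a. c a + c' a"]) auto
qed

lemma total_degree_le_zero: "total_degree_le d (\<lambda>x. 0)"
  unfolding total_degree_le_def by (intro exI[of _ "\<lambda>_. 0"]) simp

lemma total_degree_le_sum:
  assumes "\<And>i. i \<in> I \<Longrightarrow> total_degree_le d (p i)"
  shows "total_degree_le d (\<lambda>x. \<Sum>i\<in>I. p i x)"
  using assms
  by (induction I rule: infinite_finite_induct)
    (auto intro: total_degree_le_add total_degree_le_zero)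

lemma total_degree_le_mono:
  assumes "total_degree_le d p" "d \<le> e"
  shows "total_degree_le e p"
proof -
  obtain c where "\<And>x. p x = (\<Sum>a | sum a UNIV \<le> d. c a * monomial_fun a x)"
    using assms unfolding total_degree_le_def by blast
  then have p: "p = (\<lambda>x. \<Sum>a | sum a UNIV \<le> d. c a * monomial_fun a x)"
    by (rule ext)
  show ?thesis
    unfolding p
  proof (rule total_degree_le_sum)
    fix a :: "'a \<Rightarrow> nat"
    assume "a \<in> {a. sum a UNIV \<le> d}"
    then show "total_degree_le e (\<lambda>x. c a * monomial_fun a x)"
      using assms(2) by (intro total_degree_le_monomial) simp
  qed
qed

lemma monomial_fun_add: "monomial_fun (\<lambda>i. a i + b i) x = monomial_fun a x * monomial_fun b x"
  by (simp add: monomial_fun_def power_add prod.distrib)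

lemma total_degree_le_mult:
  assumes "total_degree_le d p" "total_degree_le e q"
  shows "total_degree_le (d + e) (\<lambda>x. p x * q x)"
proof -
  obtain c c' where "\<And>x. p x = (\<Sum>a | sum a UNIV \<le> d. c a * monomial_fun a x)"
    "\<And>x. q x = (\<Sum>a | sum a UNIV \<le> e. c' a * monomial_fun a x)"
    using assms unfolding total_degree_le_def by blast
  then have pq: "(\<lambda>x. p x * q x) = (\<lambda>x. \<Sum>a | sum a UNIV \<le> d. \<Sum>b | sum b UNIV \<le> e.
      (c a * c' b) * monomial_fun (\<lambda>i. a i + b i) x)"
    by (intro ext) (simp only: sum_product, intro sum.cong refl, simp add: monomial_fun_add)
  show ?thesis
    unfolding pq
  proof (intro total_degree_le_sum)
    fix a b :: "'a \<Rightarrow> nat"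
    assume "a \<in> {a. sum a UNIV \<le> d}" "b \<in> {b. sum b UNIV \<le> e}"
    then show "total_degree_le (d + e) (\<lambda>x. (c a * c' b) * monomial_fun (\<lambda>i. a i + b i) x)"
      by (intro total_degree_le_monomial) (simp add: sum.distrib add_mono)
  qed
qed

lemma real_polynomial_function_iff:
  fixes p :: "real ^ 'n::finite \<Rightarrow> real"
  shows "real_polynomial_function p \<longleftrightarrow> (\<exists>d. total_degree_le d p)"
proof
  show "\<exists>d. total_degree_le d p" if "real_polynomial_function p"
    using that
  proof induction
    case (linear f)
    have mon: "monomial_fun (\<lambda>j. if j = i then 1 else 0) x = x $ i" for i :: 'n and x
    proof -
      have "monomial_fun (\<lambda>j. if j = i then 1 else 0) x = (\<Prod>j\<in>UNIV. if j = i then x $ j else 1)"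
        unfolding monomial_fun_def by (rule prod.cong) auto
      then show ?thesis by simp
    qed
    have "f = (\<lambda>x. \<Sum>i\<in>UNIV. f (axis i 1) * monomial_fun (\<lambda>j. if j = i then 1 else 0) x)"
    proof
      fix x
      interpret bounded_linear f by fact
      have "f x = f (\<Sum>i\<in>UNIV. x $ i *\<^sub>R axis i 1)"
        using basis_expansion[of x] by (simp add: scalar_mult_eq_scaleR)
      also have "\<dots> = (\<Sum>i\<in>UNIV. f (axis i 1) * x $ i)"
        by (simp add: sum scaleR mult.commute)
      finally show "f x = (\<Sum>i\<in>UNIV. f (axis i 1) * monomial_fun (\<lambda>j. if j = i then 1 else 0) x)"
        by (simp add: mon)
    qed
    moreover have "total_degree_le 1
      (\<lambda>x. \<Sum>i\<in>UNIV. f (axis i 1) * monomial_fun (\<lambda>j. if j = i then 1 else 0) x)"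
      by (intro total_degree_le_sum total_degree_le_monomial) simp
    ultimately have "total_degree_le 1 f"
      by (rule ssubst[where P = "total_degree_le 1"])
    then show ?case ..
  next
    case (const c)
    have "total_degree_le 0 (\<lambda>x :: real ^ 'n. c * monomial_fun (\<lambda>_. 0) x)"
      by (rule total_degree_le_monomial) simp
    then show ?case by (auto simp: monomial_fun_def)
  next
    case (add f g)
    then obtain d e where "total_degree_le d f" "total_degree_le e g"
      by blast
    then have "total_degree_le (max d e) f" "total_degree_le (max d e) g"
      by (auto elim: total_degree_le_mono)
    then show ?case
      by (intro exI total_degree_le_add)
  next
    case (mult f g)
    then obtain d e where "total_degree_le d f" "total_degree_le e g"
      by blast
    then have "total_degree_le (d + e) (\<lambda>x. f x * g x)"
      by (rule total_degree_le_mult)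
    then show ?case ..
  qed
next
  assume "\<exists>d. total_degree_le d p"
  then obtain d c where "\<And>x. p x = (\<Sum>a | sum a UNIV \<le> d. c a * monomial_fun a x)"
    unfolding total_degree_le_def by blast
  then have p: "p = (\<lambda>x. \<Sum>a | sum a UNIV \<le> d. c a * monomial_fun a x)"
    by (rule ext)
  have "real_polynomial_function (\<lambda>x :: real ^ 'n. x $ i)" for i
    by (intro real_polynomial_function.intros(1) bounded_linear_vec_nth)
  then have "real_polynomial_function (monomial_fun a)" for a :: "'n \<Rightarrow> nat"
    unfolding monomial_fun_def[abs_def]
    by (intro real_polynomial_function_prod[OF finite] real_polynomial_function_power)
  then have "real_polynomial_function (\<lambda>x. c a * monomial_fun a x)" for a
    by (rule real_polynomial_function.intros(4)[OF real_polynomial_function.intros(2)])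
  then show "real_polynomial_function p"
    unfolding p by (rule real_polynomial_function_sum[OF finite_total_degree])
qed

lemma poly_fun_degree_le_iff:
  assumes "real_polynomial_function p"
  shows "poly_fun_degree p \<le> d \<longleftrightarrow> total_degree_le d p"
proof -
  obtain e where "total_degree_le e p"
    using assms real_polynomial_function_iff by blast
  then have "total_degree_le (poly_fun_degree p) p"
    unfolding poly_fun_degree_def by (rule LeastI)
  then show ?thesis
    unfolding poly_fun_degree_def by (auto elim: total_degree_le_mono intro: Least_le)
qed

lemma gradient_eq:
  assumes "GDERIV V x :> D"
  shows "gradient V x = D"
  unfolding gradient_def
proof (rule the_equality)
  fix D'
  assume "GDERIV V x :> D'"
  with assms have "(\<lambda>h. h \<bullet> D') = (\<lambda>h. h \<bullet> D)"
    unfolding gderiv_def by (rule has_derivative_unique[rotated])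
  then show "D' = D"
    unfolding fun_eq_iff vector_eq_ldot .
qed (fact assms)

end

theory Submission
  imports Defs
begin

text \<open>
  Let \<open>\<phi>(x, t)\<close> be the flow, \<open>\<delta> = ln (2 * K\<^sup>2) / (2 * lam)\<close> and \<open>\<Lambda> = L * \<delta>\<close>, so that
  \<open>norm (\<phi>(x, \<delta>))\<^sup>2 \<le> norm x\<^sup>2 / 2\<close>. The function \<open>V\<close> is a Riemann sum for the integral over
  \<open>[0, \<delta>]\<close> of \<open>norm (z(x, t))\<^sup>2\<close>, where \<open>z\<close> is a Picard iterate, itself discretised by the Euler
  scheme. Hence \<open>V\<close> is a finite sum of squares of polynomials, and \<open>J\<close> iterations give degree
  \<open>2 * q ^ J\<close>. Plain Picard iterates may leave the ball on which \<open>f\<close> is Lipschitz when \<open>\<Lambda>\<close> is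
  large, so the \<open>j\<close>-th iterate is updated only up to a frontier time growing with \<open>j\<close> and is
  constant in time beyond it.

  If \<open>\<psi>\<close> is the derivative of \<open>z\<close> in direction \<open>f x\<close>, the derivative of \<open>V\<close> along \<open>f\<close> is the integral
  of \<open>2 * z \<bullet> \<psi>\<close>, that is \<open>norm (z(x, \<delta>))\<^sup>2 - norm x\<^sup>2\<close> up to the contribution of the defect
  \<open>\<partial>z/\<partial>t - \<psi>\<close>. Both the error \<open>z - \<phi>\<close> and the defect satisfy discrete Volterra inequalities in
  \<open>j\<close>, and explicit supersolutions of them suffice for negativity in two cases: \<open>5 * \<Lambda> \<le> J\<close> (moving
  frontier, exponential supersolutions), and \<open>\<Lambda> \<le> 1\<close> together with a smallness condition on
  \<open>\<Lambda> ^ (J + 1) / (J + 1)!\<close> (no frontier, factorial supersolutions). The numerical hypothesis on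
  \<open>c k\<close> puts \<open>J = N * k - 1\<close> into the first case, or else \<open>J = 1\<close> or \<open>J = 2\<close> into the second.
\<close>

section \<open>Polynomial functions\<close>

lemma total_degree_le_const: "total_degree_le d (\<lambda>x. c)"
  using total_degree_le_monomial[of "\<lambda>_. 0" d c] by (simp add: monomial_fun_def)

lemma total_degree_le_nth: "total_degree_le 1 (\<lambda>x. x $ i)"
proof -
  have "monomial_fun (\<lambda>j. if j = i then 1 else 0) x = (\<Prod>j\<in>UNIV. if j = i then x $ j else 1)" for x
    unfolding monomial_fun_def by (rule prod.cong) auto
  then show ?thesis
    using total_degree_le_monomial[of "\<lambda>j. if j = i then 1 else 0" 1 1] by simp
qed

lemma total_degree_le_cmult: "total_degree_le d p \<Longrightarrow> total_degree_le d (\<lambda>x. c * p x)"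
  using total_degree_le_mult[OF total_degree_le_const[of 0 c]] by fastforce

lemma total_degree_le_power: "total_degree_le d p \<Longrightarrow> total_degree_le (n * d) (\<lambda>x. p x ^ n)"
  by (induction n) (use total_degree_le_const total_degree_le_mult in force)+

lemma total_degree_le_prod:
  assumes "\<And>i. i \<in> I \<Longrightarrow> total_degree_le (d i) (p i)"
  shows "total_degree_le (sum d I) (\<lambda>x. \<Prod>i\<in>I. p i x)"
  using assms
  by (induction I rule: infinite_finite_induct)
    (auto intro: total_degree_le_const total_degree_le_mult)

lemma total_degree_le_compose:
  assumes p: "total_degree_le e p" and z: "\<And>i. total_degree_le d (\<lambda>x. z x $ i)"
  shows "total_degree_le (e * d) (\<lambda>x. p (z x))"
proof -
  obtain c where c: "\<And>x. p x = (\<Sum>a | sum a UNIV \<le> e. c a * monomial_fun a x)"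
    using p unfolding total_degree_le_def by blast
  show ?thesis
    unfolding c monomial_fun_def
  proof (intro total_degree_le_sum total_degree_le_cmult)
    fix a :: "'a \<Rightarrow> nat"
    assume "a \<in> {a. sum a UNIV \<le> e}"
    then have "(\<Sum>i\<in>UNIV. a i * d) \<le> e * d"
      by (simp flip: sum_distrib_right)
    moreover have "total_degree_le (\<Sum>i\<in>UNIV. a i * d) (\<lambda>x. \<Prod>i\<in>UNIV. (z x $ i) ^ a i)"
      by (intro total_degree_le_prod total_degree_le_power z)
    ultimately show "total_degree_le (e * d) (\<lambda>x. \<Prod>i\<in>UNIV. (z x $ i) ^ a i)"
      by (blast intro: total_degree_le_mono)
  qed
qed

lemma sum_of_squares_sum:
  assumes "finite I" and "\<And>i. i \<in> I \<Longrightarrow> real_polynomial_function (p i)"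
  shows "sum_of_squares (\<lambda>x. \<Sum>i\<in>I. (p i x)\<^sup>2)"
proof -
  obtain b where b: "bij_betw b {..<card I} I"
    using ex_bij_betw_nat_finite[OF assms(1)] by (auto simp: lessThan_atLeast0)
  have "(\<Sum>i\<in>I. (p i x)\<^sup>2) = (\<Sum>j<card I. (p (b j) x)\<^sup>2)" for x
    by (rule sum.reindex_bij_betw[OF b, symmetric])
  moreover have "real_polynomial_function (p (b j))" if "j < card I" for j
    using assms(2) bij_betwE[OF b] that by blast
  ultimately show ?thesis
    unfolding sum_of_squares_def by (intro exI[of _ "card I"] exI[of _ "\<lambda>j. p (b j)"]) auto
qed

lemma polynomial_function_nth:
  fixes f :: "'a::real_normed_vector \<Rightarrow> real ^ 'n::finite"
  assumes "polynomial_function f"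
  shows "real_polynomial_function (\<lambda>x. f x $ i)"
  using assms bounded_linear_vec_nth[of i] unfolding polynomial_function_def o_def by blast

section \<open>Second-order Taylor bounds for polynomial maps on a ball\<close>

text \<open>Bounds on values and increments accompany the Taylor bound because the remainder of a
  product involves all three; with them the predicate survives the induction over
  polynomials.\<close>

definition quadratic_remainder ::
    "real \<Rightarrow> ('a::real_normed_vector \<Rightarrow> real) \<Rightarrow> ('a \<Rightarrow> 'a \<Rightarrow> real) \<Rightarrow> real \<Rightarrow> bool" where
  "quadratic_remainder R p p' C \<longleftrightarrow> C \<ge> 0 \<and> (\<forall>a. (p has_derivative p' a) (at a)) \<and>
    (\<forall>a\<in>cball 0 R. \<bar>p a\<bar> \<le> C \<and> (\<forall>b\<in>cball 0 R. \<bar>p b - p a\<bar> \<le> C * norm (b - a) \<and>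
      \<bar>p b - p a - p' a (b - a)\<bar> \<le> C * (norm (b - a))\<^sup>2))"

lemma quadratic_remainderD:
  assumes "quadratic_remainder R p p' C"
  shows "C \<ge> 0" "\<And>a. (p has_derivative p' a) (at a)"
    "\<And>a. a \<in> cball 0 R \<Longrightarrow> \<bar>p a\<bar> \<le> C"
    "\<And>a b. a \<in> cball 0 R \<Longrightarrow> b \<in> cball 0 R \<Longrightarrow> \<bar>p b - p a\<bar> \<le> C * norm (b - a)"
    "\<And>a b. a \<in> cball 0 R \<Longrightarrow> b \<in> cball 0 R \<Longrightarrow> \<bar>p b - p a - p' a (b - a)\<bar> \<le> C * (norm (b - a))\<^sup>2"
  using assms unfolding quadratic_remainder_def by blast+

lemma real_polynomial_quadratic_remainder:
  fixes p :: "'a::real_normed_vector \<Rightarrow> real"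
  assumes "real_polynomial_function p" "R \<ge> 0"
  shows "\<exists>p' C. quadratic_remainder R p p' C"
  using assms
proof induction
  case (linear p)
  interpret bounded_linear p by fact
  obtain C where C: "C > 0" "\<And>x. norm (p x) \<le> norm x * C"
    using pos_bounded by blast
  show ?case
  unfolding quadratic_remainder_def
  \<comment> \<open>\<open>C * R\<close> bounds the values on the ball, \<open>C\<close> the
    increments, and the remainder of a linear map is zero.\<close>
  proof (intro exI[of _ "\<lambda>a. p"] exI[of _ "C * (R + 1)"] conjI allI ballI)
    fix a b :: 'a assume a: "a \<in> cball 0 R" and "b \<in> cball 0 R"
    have "\<bar>p a\<bar> \<le> R * C"
      using C(2)[of a] a C(1) by (simp add: mult_right_mono order_trans)
    also have "\<dots> \<le> C * (R + 1)"
      using C(1) by (simp add: algebra_simps)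
    finally show "\<bar>p a\<bar> \<le> C * (R + 1)" .
    have "\<bar>p b - p a\<bar> \<le> norm (b - a) * C"
      using C(2)[of "b - a"] by (simp add: diff)
    also have "\<dots> \<le> C * (R + 1) * norm (b - a)"
      using C(1) linear.prems by (simp add: algebra_simps)
    finally show "\<bar>p b - p a\<bar> \<le> C * (R + 1) * norm (b - a)" .
    show "\<bar>p b - p a - p (b - a)\<bar> \<le> C * (R + 1) * (norm (b - a))\<^sup>2"
      using C(1) linear.prems by (simp add: diff)
  next
    show "(p has_derivative p) (at a)" for a
      by (intro bounded_linear_imp_has_derivative) fact
  qed (use C(1) linear.prems in simp)
next
  case (const c)
  then show ?case
    unfolding quadratic_remainder_def
    by (intro exI[of _ "\<lambda>_ _. 0"] exI[of _ "\<bar>c\<bar>"]) auto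
next
  case (add p q)
  then obtain p' C q' D where "quadratic_remainder R p p' C" "quadratic_remainder R q q' D"
    by blast
  note C = quadratic_remainderD[OF this(1)] and D = quadratic_remainderD[OF this(2)]
  show ?case
  unfolding quadratic_remainder_def
  proof (intro exI[of _ "\<lambda>a v. p' a v + q' a v"] exI[of _ "C + D"] conjI allI ballI)
    fix a b :: 'a assume ab: "a \<in> cball 0 R" "b \<in> cball 0 R"
    show "\<bar>p a + q a\<bar> \<le> C + D"
      using C(3)[OF ab(1)] D(3)[OF ab(1)] by linarith
    show "\<bar>p b + q b - (p a + q a)\<bar> \<le> (C + D) * norm (b - a)"
      using C(4)[OF ab] D(4)[OF ab] unfolding distrib_right by linarith
    show "\<bar>p b + q b - (p a + q a) - (p' a (b - a) + q' a (b - a))\<bar> \<le> (C + D) * (norm (b - a))\<^sup>2"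
      using C(5)[OF ab] D(5)[OF ab] unfolding distrib_right by linarith
  qed (use C(1,2) D(1,2) in \<open>auto intro: has_derivative_add\<close>)
next
  case (mult p q)
  then obtain p' C q' D where "quadratic_remainder R p p' C" "quadratic_remainder R q q' D"
    by blast
  note C = quadratic_remainderD[OF this(1)] and D = quadratic_remainderD[OF this(2)]
  show ?case
  unfolding quadratic_remainder_def
  proof (intro exI[of _ "\<lambda>a v. p a * q' a v + p' a v * q a"] exI[of _ "3 * (C * D)"] conjI allI ballI)
    fix a b :: 'a assume ab: "a \<in> cball 0 R" "b \<in> cball 0 R"
    have "\<bar>p a * q a\<bar> \<le> C * D"
      unfolding abs_mult using C(1,3) D(1,3) ab by (intro mult_mono) auto
    with C(1) D(1) show "\<bar>p a * q a\<bar> \<le> 3 * (C * D)"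
      by (smt (verit) mult_nonneg_nonneg)
    let ?n = "norm (b - a)"
    have 1: "\<bar>(p b - p a) * q b\<bar> \<le> C * ?n * D" "\<bar>p a * (q b - q a)\<bar> \<le> C * (D * ?n)"
      unfolding abs_mult using C D ab by (intro mult_mono; auto)+
    have "p b * q b - p a * q a = (p b - p a) * q b + p a * (q b - q a)"
      by (simp add: algebra_simps)
    with 1 have "\<bar>p b * q b - p a * q a\<bar> \<le> 2 * (C * D * ?n)"
      by (simp add: mult_ac)
    also have "\<dots> \<le> 3 * (C * D * ?n)"
      using C(1) D(1) by (intro mult_right_mono) auto
    finally show "\<bar>p b * q b - p a * q a\<bar> \<le> 3 * (C * D) * ?n"
      by (simp add: mult_ac)
    have 2: "\<bar>(p b - p a) * (q b - q a)\<bar> \<le> (C * ?n) * (D * ?n)"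
      "\<bar>p a * (q b - q a - q' a (b - a))\<bar> \<le> C * (D * ?n\<^sup>2)"
      "\<bar>(p b - p a - p' a (b - a)) * q a\<bar> \<le> C * ?n\<^sup>2 * D"
      unfolding abs_mult using C D ab by (intro mult_mono; auto)+
    \<comment> \<open>Each of the three terms contributes at most \<open>C * D\<close> times the
      squared distance, hence the factor 3 in the witness.\<close>
    have "p b * q b - p a * q a - (p a * q' a (b - a) + p' a (b - a) * q a) =
      (p b - p a) * (q b - q a) + p a * (q b - q a - q' a (b - a)) + (p b - p a - p' a (b - a)) * q a"
      by (simp add: algebra_simps)
    with 2 show "\<bar>p b * q b - p a * q a - (p a * q' a (b - a) + p' a (b - a) * q a)\<bar>
        \<le> 3 * (C * D) * ?n\<^sup>2"
      by (simp add: mult_ac power2_eq_square)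
  next
    show "((\<lambda>x. p x * q x) has_derivative (\<lambda>v. p a * q' a v + p' a v * q a)) (at a)" for a
      by (intro has_derivative_mult C D)
  qed (use C(1) D(1) in simp)
qed

lemma polynomial_quadratic_remainder:
  fixes f :: "'a::real_normed_vector \<Rightarrow> 'b::euclidean_space"
  assumes "polynomial_function f" "R \<ge> 0"
  obtains f' C where "C \<ge> 0" "\<And>a. (f has_derivative f' a) (at a)"
    "\<And>a b. a \<in> cball 0 R \<Longrightarrow> b \<in> cball 0 R \<Longrightarrow>
      norm (f b - f a - f' a (b - a)) \<le> C * (norm (b - a))\<^sup>2"
proof -
  have "\<forall>i\<in>Basis. \<exists>p' C. quadratic_remainder R (\<lambda>x. f x \<bullet> i) p' C"
    using real_polynomial_quadratic_remainder[OF _ assms(2)] assms(1)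
    unfolding polynomial_function_iff_Basis_inner by blast
  then obtain p' C where "\<And>i. i \<in> Basis \<Longrightarrow> quadratic_remainder R (\<lambda>x. f x \<bullet> i) (p' i) (C i)"
    by metis
  note C = quadratic_remainderD[OF this]
  define f' where "f' a v = (\<Sum>i\<in>Basis. p' i a v *\<^sub>R i)" for a v
  have f': "f' a v \<bullet> i = p' i a v" if "i \<in> Basis" for a v i
    using that by (simp add: f'_def)
  show thesis
  proof
    show "0 \<le> sum C Basis"
      using C(1) by (rule sum_nonneg)
    show "(f has_derivative f' a) (at a)" for a
      by (subst has_derivative_componentwise_within) (simp add: f' C(2))
    fix a b :: 'a assume ab: "a \<in> cball 0 R" "b \<in> cball 0 R"
    have "norm (f b - f a - f' a (b - a)) \<le> (\<Sum>i\<in>Basis. \<bar>(f b - f a - f' a (b - a)) \<bullet> i\<bar>)"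
      by (rule norm_le_l1)
    also have "\<dots> \<le> (\<Sum>i\<in>Basis. C i * (norm (b - a))\<^sup>2)"
      by (intro sum_mono) (use C(5) ab in \<open>simp add: inner_diff_left f'\<close>)
    finally show "norm (f b - f a - f' a (b - a)) \<le> sum C Basis * (norm (b - a))\<^sup>2"
      by (simp add: sum_distrib_right)
  qed
qed

text \<open>Difference quotients along \<open>v\<close> are at most \<open>L * norm v\<close>, and
  the derivative is their limit. Interiority lets short steps in every direction stay in
  \<open>S\<close>.\<close>

lemma has_derivative_lipschitz_bound:
  fixes f :: "'a::real_normed_vector \<Rightarrow> 'b::real_normed_vector"
  assumes d: "(f has_derivative f') (at a)" and L: "L-lipschitz_on S f" and a: "a \<in> interior S"
  shows "norm (f' v) \<le> L * norm v"
proof -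
  interpret bounded_linear f' using d by (rule has_derivative_bounded_linear)
  obtain e where e: "e > 0" "ball a e \<subseteq> S"
    using a by (meson mem_interior)
  have aS: "a \<in> S" using a interior_subset by blast
  have "norm (f' v) \<le> L * norm v + \<epsilon>" if "\<epsilon> > 0" for \<epsilon>
  proof (cases "v = 0")
    case False
    define \<epsilon>' where "\<epsilon>' = \<epsilon> / norm v"
    have "\<epsilon>' > 0" using that False by (simp add: \<epsilon>'_def)
    then obtain \<delta> where \<delta>: "\<delta> > 0"
      "\<And>y. norm (y - a) < \<delta> \<Longrightarrow> norm (f y - f a - f' (y - a)) \<le> \<epsilon>' * norm (y - a)"
      using d unfolding has_derivative_at_alt by blast
    define t where "t = min e \<delta> / (2 * norm v)"
    have t: "t > 0" "norm (t *\<^sub>R v) < e" "norm (t *\<^sub>R v) < \<delta>"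
      using e(1) \<delta>(1) False by (auto simp: t_def)
    have "a + t *\<^sub>R v \<in> S"
      using t(2) by (intro subsetD[OF e(2)]) (simp add: dist_norm)
    then have "norm (f (a + t *\<^sub>R v) - f a) \<le> L * norm (t *\<^sub>R v)"
      using lipschitz_onD[OF L, of "a + t *\<^sub>R v" a] aS by (auto simp: dist_norm)
    moreover have "norm (f (a + t *\<^sub>R v) - f a - f' (t *\<^sub>R v)) \<le> \<epsilon>' * norm (t *\<^sub>R v)"
      using \<delta>(2)[of "a + t *\<^sub>R v"] t(3) by simp
    ultimately have "norm (f' (t *\<^sub>R v)) \<le> L * norm (t *\<^sub>R v) + \<epsilon>' * norm (t *\<^sub>R v)"
      using norm_triangle_sub[of "f' (t *\<^sub>R v)" "f (a + t *\<^sub>R v) - f a"]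
      by (simp only: norm_minus_commute)
    then have "t * norm (f' v) \<le> t * (L * norm v + \<epsilon>)"
      using t(1) False by (simp add: scale \<epsilon>'_def algebra_simps)
    then show ?thesis
      using t(1) by simp
  qed (use that in \<open>simp add: zero\<close>)
  then show ?thesis
    by (rule field_le_epsilon)
qed

section \<open>Discretised Picard iteration with a moving frontier\<close>

text \<open>
  \<open>picard f h F j x m\<close> approximates the solution at time \<open>h * m\<close>; \<open>F j\<close> is the index of the
  frontier in the \<open>j\<close>-th iterate.
\<close>

primrec picard :: "('a \<Rightarrow> 'a) \<Rightarrow> real \<Rightarrow> (nat \<Rightarrow> nat) \<Rightarrow> nat \<Rightarrow> 'a::real_vector \<Rightarrow> nat \<Rightarrow> 'a" where
  "picard f h F 0 x m = x"
| "picard f h F (Suc j) x m = x + h *\<^sub>R (\<Sum>l<min m (F (Suc j)). f (picard f h F j x l))"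

primrec picard_deriv ::
    "('a \<Rightarrow> 'a) \<Rightarrow> ('a \<Rightarrow> 'a \<Rightarrow> 'a) \<Rightarrow> real \<Rightarrow> (nat \<Rightarrow> nat) \<Rightarrow> nat \<Rightarrow> 'a::real_vector \<Rightarrow> 'a \<Rightarrow> nat \<Rightarrow> 'a"
  where
  "picard_deriv f f' h F 0 x v m = v"
| "picard_deriv f f' h F (Suc j) x v m =
     v + h *\<^sub>R (\<Sum>l<min m (F (Suc j)). f' (picard f h F j x l) (picard_deriv f f' h F j x v l))"

definition picard_lyapunov ::
    "('a \<Rightarrow> 'a) \<Rightarrow> real \<Rightarrow> (nat \<Rightarrow> nat) \<Rightarrow> nat \<Rightarrow> nat \<Rightarrow> 'a::real_inner \<Rightarrow> real" where
  "picard_lyapunov f h F J M x = h * (\<Sum>m<M. (norm (picard f h F J x m))\<^sup>2)"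

lemma picard_at_0 [simp]: "picard f h F j x 0 = x"
  by (cases j) auto

lemma picard_beyond_frontier:
  assumes "F 0 = 0" "F j \<le> m"
  shows "picard f h F j x m = picard f h F j x (F j)"
  using assms by (cases j) (auto simp: min_def)

lemma picard_deriv_beyond_frontier:
  assumes "F 0 = 0" "F j \<le> m"
  shows "picard_deriv f f' h F j x v m = picard_deriv f f' h F j x v (F j)"
  using assms by (cases j) (auto simp: min_def)

text \<open>The discrete form of the statement that the time derivative of iterate
  \<open>j + 1\<close> is \<open>f\<close> at iterate \<open>j\<close>. It holds strictly below the
  frontier.\<close>

lemma picard_Suc_Suc:
  "l < F (Suc j) \<Longrightarrow>
    picard f h F (Suc j) x (Suc l) - picard f h F (Suc j) x l = h *\<^sub>R f (picard f h F j x l)"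
  by (simp add: min_def algebra_simps)

lemma has_derivative_picard:
  fixes f :: "'a::real_normed_vector \<Rightarrow> 'a"
  assumes "\<And>a. (f has_derivative f' a) (at a)"
  shows "((\<lambda>x. picard f h F j x m) has_derivative (\<lambda>v. picard_deriv f f' h F j x v m)) (at x)"
proof (induction j arbitrary: m)
  case (Suc j)
  have "((\<lambda>x. f (picard f h F j x l)) has_derivative
      (\<lambda>v. f' (picard f h F j x l) (picard_deriv f f' h F j x v l))) (at x)" for l
    using has_derivative_compose[OF Suc assms] .
  then show ?case
    by (auto intro!: derivative_eq_intros)
qed (auto intro: derivative_eq_intros)

section \<open>Degree, sum-of-squares form and gradient of the discretised functional\<close>

text \<open>Every iteration composes with \<open>f\<close> once and so multiplies the degree by
  \<open>q\<close>; \<open>q \<ge> 1\<close> leaves room for the summand \<open>x\<close>.\<close>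

lemma total_degree_le_picard:
  fixes f :: "real ^ 'n::finite \<Rightarrow> real ^ 'n"
  assumes f: "\<And>i. total_degree_le q (\<lambda>x. f x $ i)" and q: "q \<ge> 1"
  shows "total_degree_le (q ^ j) (\<lambda>x. picard f h F j x m $ i)"
proof (induction j arbitrary: m i)
  case 0
  then show ?case using total_degree_le_nth by simp
next
  case (Suc j)
  have "total_degree_le (q ^ Suc j) (\<lambda>x. x $ i)"
    by (rule total_degree_le_mono[OF total_degree_le_nth]) (use q in simp)
  moreover have "total_degree_le (q ^ Suc j) (\<lambda>x. f (picard f h F j x l) $ i)" for l
    using total_degree_le_compose[OF f Suc] by simp
  ultimately show ?case
    by (auto intro!: total_degree_le_add total_degree_le_cmult total_degree_le_sum)
qed

lemma picard_lyapunov_eq_sum_squares: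
  fixes f :: "real ^ 'n::finite \<Rightarrow> real ^ 'n"
  assumes "h \<ge> 0"
  shows "picard_lyapunov f h F J M x =
    (\<Sum>mi\<in>{..<M} \<times> UNIV. (sqrt h * picard f h F J x (fst mi) $ (snd mi))\<^sup>2)"
  using assms
  by (simp add: picard_lyapunov_def power2_norm_eq_inner inner_vec_def sum_distrib_left
      power_mult_distrib sum.cartesian_product case_prod_unfold flip: power2_eq_square)

lemma sum_of_squares_picard_lyapunov:
  fixes f :: "real ^ 'n::finite \<Rightarrow> real ^ 'n"
  assumes f: "\<And>i. total_degree_le q (\<lambda>x. f x $ i)" and q: "q \<ge> 1" and h: "h \<ge> 0"
  shows "sum_of_squares (picard_lyapunov f h F J M)"
    and "poly_fun_degree (picard_lyapunov f h F J M) \<le> 2 * q ^ J"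
proof -
  let ?V = "picard_lyapunov f h F J M"
  have V: "?V = (\<lambda>x. \<Sum>mi\<in>{..<M} \<times> UNIV. (sqrt h * picard f h F J x (fst mi) $ (snd mi))\<^sup>2)"
    by (rule ext) (rule picard_lyapunov_eq_sum_squares[OF h])
  have deg: "total_degree_le (q ^ J) (\<lambda>x. sqrt h * picard f h F J x m $ i)" for m i
    by (intro total_degree_le_cmult total_degree_le_picard f q)
  show "sum_of_squares ?V"
    unfolding V using deg real_polynomial_function_iff by (intro sum_of_squares_sum) auto
  have "total_degree_le (2 * q ^ J) ?V"
    unfolding V by (intro total_degree_le_sum total_degree_le_power deg)
  moreover from this have "real_polynomial_function ?V"
    using real_polynomial_function_iff by blast
  ultimately show "poly_fun_degree ?V \<le> 2 * q ^ J"
    by (simp add: poly_fun_degree_le_iff)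
qed

lemma gradient_inner_eq:
  fixes V :: "'a::euclidean_space \<Rightarrow> real"
  assumes "(V has_derivative V') (at x)"
  shows "gradient V x \<bullet> v = V' v"
proof -
  interpret bounded_linear V' using assms by (rule has_derivative_bounded_linear)
  let ?D = "\<Sum>b\<in>Basis. V' b *\<^sub>R b"
  have V': "V' w = w \<bullet> ?D" for w
  proof -
    have "V' w = V' (\<Sum>b\<in>Basis. (w \<bullet> b) *\<^sub>R b)"
      by (simp add: euclidean_representation)
    also have "\<dots> = w \<bullet> ?D"
      by (simp add: sum scale inner_sum_right mult.commute)
    finally show ?thesis .
  qed
  then have "V' = (\<lambda>w. w \<bullet> ?D)" by (rule ext)
  then have "GDERIV V x :> ?D"
    using assms unfolding gderiv_def by simp
  then show ?thesis
    using V'[of v] by (simp add: gradient_eq inner_commute)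
qed

lemma gradient_picard_lyapunov:
  fixes f :: "'a::euclidean_space \<Rightarrow> 'a"
  assumes "\<And>a. (f has_derivative f' a) (at a)"
  shows "gradient (picard_lyapunov f h F J M) x \<bullet> v =
    h * (\<Sum>m<M. 2 * (picard f h F J x m \<bullet> picard_deriv f f' h F J x v m))"
proof (rule gradient_inner_eq)
  show "(picard_lyapunov f h F J M has_derivative
      (\<lambda>v. h * (\<Sum>m<M. 2 * (picard f h F J x m \<bullet> picard_deriv f f' h F J x v m)))) (at x)"
    unfolding picard_lyapunov_def power2_norm_eq_inner
    by (auto intro!: derivative_eq_intros has_derivative_picard[OF assms]
        simp: inner_commute sum_distrib_left)
qed

section \<open>Error and defect of the Picard iterates\<close>

text \<open>By \<open>1 + H \<le> exp H\<close> each term is at most a telescoping difference. The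
  \<open>- 1\<close> on the right is essential later: it lets an exponential bound absorb the
  constant source terms of a recursion.\<close>

lemma sum_exp_le:
  fixes H :: real
  shows "H * (\<Sum>l<m. exp (H * real l)) \<le> exp (H * real m) - 1"
proof -
  have "H * exp (H * real l) \<le> exp (H * real (Suc l)) - exp (H * real l)" for l
  proof -
    have "(1 + H) * exp (H * real l) \<le> exp H * exp (H * real l)"
      by (intro mult_right_mono) auto
    then show ?thesis by (simp add: algebra_simps exp_add)
  qed
  then have "(\<Sum>l<m. H * exp (H * real l)) \<le> (\<Sum>l<m. exp (H * real (Suc l)) - exp (H * real l))"
    by (intro sum_mono)
  also have "\<dots> = exp (H * real m) - 1"
    by (subst sum_lessThan_telescope) simp
  finally show ?thesis by (simp add: sum_distrib_left)
qed

text \<open>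
  Below, \<open>H\<close> is the mesh in units of \<open>1 / L\<close>, \<open>g\<close> bounds the true solution, \<open>B j\<close> bounds the error of
  the \<open>j\<close>-th iterate and \<open>L * W j\<close> its defect, all relative to \<open>norm x\<close>. The extensions describe
  what happens beyond the frontier, where the iterate is constant in time: there the error
  grows by the drift of the solution, and the defect jumps by the lost time derivative.
\<close>

definition error_extension ::
    "real \<Rightarrow> (nat \<Rightarrow> nat) \<Rightarrow> (nat \<Rightarrow> real) \<Rightarrow> (nat \<Rightarrow> nat \<Rightarrow> real) \<Rightarrow> nat \<Rightarrow> nat \<Rightarrow> real" where
  "error_extension H F g B j l = (if l \<le> F j then B j l else B j (F j) + H * real (l - F j) * g (F j))"

definition defect_extension ::
    "(nat \<Rightarrow> nat) \<Rightarrow> (nat \<Rightarrow> real) \<Rightarrow> (nat \<Rightarrow> nat \<Rightarrow> real) \<Rightarrow> (nat \<Rightarrow> nat \<Rightarrow> real) \<Rightarrow> nat \<Rightarrow> nat \<Rightarrow> real"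
  where
  "defect_extension F g B W j l = (if l < F j then W j l
     else W j (F j) + (case j of 0 \<Rightarrow> 1 | Suc i \<Rightarrow> g (F i) + B i (F i)))"

text \<open>The two sums are the Volterra inequalities for error and defect without discretisation
  terms. The bounds by \<open>K\<close> confine the iterates to norm \<open>3 * K * norm x\<close>,
  where the Lipschitz constant applies.\<close>

definition admissible_profiles ::
    "real \<Rightarrow> real \<Rightarrow> (nat \<Rightarrow> nat) \<Rightarrow> nat \<Rightarrow> (nat \<Rightarrow> real) \<Rightarrow> (nat \<Rightarrow> nat \<Rightarrow> real) \<Rightarrow> (nat \<Rightarrow> nat \<Rightarrow> real) \<Rightarrow> bool"
  where
  "admissible_profiles H K F J g B W \<longleftrightarrow> 0 \<le> B 0 0 \<and> 0 \<le> W 0 0 \<and>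
     (\<forall>j\<le>J. \<forall>m\<le>F j. B j m \<le> K) \<and>
     (\<forall>j<J. \<forall>m\<le>F (Suc j). error_extension H F g B j m \<le> K \<and>
        H * (\<Sum>l<m. error_extension H F g B j l) \<le> B (Suc j) m \<and>
        H * (\<Sum>l<m. defect_extension F g B W j l) \<le> W (Suc j) m)"

text \<open>The discretisation adds \<open>O(H)\<close> terms to \<open>B\<close> and \<open>W\<close>, with the following constants.\<close>

definition error_rate :: "real \<Rightarrow> real \<Rightarrow> real \<Rightarrow> real" where
  "error_rate H \<Lambda> K = H * \<Lambda> * K"

definition defect_rate :: "real \<Rightarrow> real \<Rightarrow> real \<Rightarrow> real \<Rightarrow> real \<Rightarrow> real \<Rightarrow> real" where
  "defect_rate H \<Lambda> K C r L = \<Lambda> * (error_rate H \<Lambda> K * exp \<Lambda>) + 9 * \<Lambda> * H * C * K\<^sup>2 * r / L"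

text \<open>The true solution enters only through its samples \<open>X m\<close> at times
  \<open>h * m\<close>: a norm bound, the one-step Euler error and the drift. All estimates of this
  locale are therefore purely discrete.\<close>

locale picard_trajectory =
  fixes f :: "'a::euclidean_space \<Rightarrow> 'a" and f' :: "'a \<Rightarrow> 'a \<Rightarrow> 'a"
    and L K r C h \<Lambda> :: real and F :: "nat \<Rightarrow> nat" and J :: nat
    and g :: "nat \<Rightarrow> real" and B W :: "nat \<Rightarrow> nat \<Rightarrow> real"
    and x :: 'a and X :: "nat \<Rightarrow> 'a"
  assumes pos: "L > 0" "K \<ge> 1" "r > 0" "C \<ge> 0" "h > 0" "\<Lambda> \<ge> 0"
    and f_zero: "f 0 = 0"
    and lipschitz: "L-lipschitz_on (cball 0 (4 * K * r)) f"
    and f': "\<And>a. (f has_derivative f' a) (at a)"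
    and remainder: "\<And>a b. a \<in> cball 0 (4 * K * r) \<Longrightarrow> b \<in> cball 0 (4 * K * r) \<Longrightarrow>
      norm (f b - f a - f' a (b - a)) \<le> C * (norm (b - a))\<^sup>2"
    and F: "F 0 = 0" "mono F"
    and horizon: "h * L * real (F J) \<le> \<Lambda>"
    and g: "\<And>m. 0 \<le> g m" "\<And>m. g m \<le> K"
    and profiles: "admissible_profiles (h * L) K F J g B W"
    and mesh: "error_rate (h * L) \<Lambda> K * exp \<Lambda> \<le> K"
    and x: "norm x \<le> r"
    and X_0: "X 0 = x"
    and X_norm: "\<And>m. norm (X m) \<le> g m * norm x"
    and X_step: "\<And>m. norm (X (Suc m) - X m - h *\<^sub>R f (X m)) \<le> (h * L)\<^sup>2 * K * norm x"
    and X_drift: "\<And>m i. norm (X (m + i) - X m) \<le> h * L * real i * g m * norm x"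
begin

definition "H = h * L"

definition "\<eta> = error_rate H \<Lambda> K"

definition "\<theta> = defect_rate H \<Lambda> K C r L"

lemma \<eta>_def': "\<eta> = H * \<Lambda> * K"
  by (simp add: \<eta>_def error_rate_def)

lemma \<theta>_def': "\<theta> = \<Lambda> * (\<eta> * exp \<Lambda>) + 9 * \<Lambda> * H * C * K\<^sup>2 * r / L"
  by (simp add: \<theta>_def defect_rate_def \<eta>_def)

abbreviation "B_ext \<equiv> error_extension H F g B"

abbreviation "W_ext \<equiv> defect_extension F g B W"

abbreviation "z \<equiv> picard f h F"

abbreviation "\<psi> j \<equiv> picard_deriv f f' h F j x (f x)"

lemma B_0: "0 \<le> B 0 0" and W_0: "0 \<le> W 0 0"
  and B_le: "j \<le> J \<Longrightarrow> m \<le> F j \<Longrightarrow> B j m \<le> K"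
  and B_ext_le: "j < J \<Longrightarrow> m \<le> F (Suc j) \<Longrightarrow> B_ext j m \<le> K"
  and B_ext_sum: "j < J \<Longrightarrow> m \<le> F (Suc j) \<Longrightarrow> H * (\<Sum>l<m. B_ext j l) \<le> B (Suc j) m"
  and W_ext_sum: "j < J \<Longrightarrow> m \<le> F (Suc j) \<Longrightarrow> H * (\<Sum>l<m. W_ext j l) \<le> W (Suc j) m"
  using profiles unfolding admissible_profiles_def H_def by blast+

lemma \<eta>_le: "\<eta> * exp \<Lambda> \<le> K"
  using mesh by (simp add: \<eta>_def H_def)

lemma H_pos: "H > 0" and \<eta>_nonneg: "\<eta> \<ge> 0" and \<theta>_nonneg: "\<theta> \<ge> 0"
  using pos by (auto simp: H_def \<eta>_def' \<theta>_def')

lemma F_le: "j \<le> J \<Longrightarrow> F j \<le> F J"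
  using F(2) by (rule monoD)

lemma F_Suc: "F j \<le> F (Suc j)"
  using F(2) by (rule monoD) simp

lemma exp_le_exp_horizon: "m \<le> F J \<Longrightarrow> exp (H * real m) \<le> exp \<Lambda>"
proof -
  assume "m \<le> F J"
  then have "H * real m \<le> H * real (F J)" using H_pos by simp
  also have "\<dots> \<le> \<Lambda>" using horizon by (simp add: H_def)
  finally show ?thesis by simp
qed

text \<open>The gap between the factors 3 and 4 makes the inequality strict, which gives the
  interior point required in \<open>f'_bound\<close>.\<close>

lemma in_ball: "norm a \<le> 3 * K * norm x \<Longrightarrow> norm a < 4 * K * r"
proof -
  assume "norm a \<le> 3 * K * norm x"
  also have "\<dots> \<le> 3 * K * r" using x pos by (intro mult_left_mono) auto
  also have "\<dots> < 4 * K * r" using pos by simp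
  finally show ?thesis .
qed

lemma in_cball: "norm a \<le> 3 * K * norm x \<Longrightarrow> a \<in> cball 0 (4 * K * r)"
  using in_ball by fastforce

lemma f'_bound: "norm a \<le> 3 * K * norm x \<Longrightarrow> norm (f' a v) \<le> L * norm v"
  using in_ball[of a] by (intro has_derivative_lipschitz_bound[OF f' lipschitz]) simp

lemma f_norm: "norm a \<le> 3 * K * norm x \<Longrightarrow> norm (f a) \<le> L * norm a"
  using lipschitz_onD[OF lipschitz, of a 0] in_cball[of a] in_cball[of 0] pos f_zero
  by (simp add: dist_norm)

lemma f_dist: "norm a \<le> 3 * K * norm x \<Longrightarrow> norm b \<le> 3 * K * norm x \<Longrightarrow>
    norm (f a - f b) \<le> L * norm (a - b)"
  using lipschitz_onD[OF lipschitz, of a b] in_cball[of a] in_cball[of b] by (simp add: dist_norm)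

lemma X_in: "norm (X m) \<le> 3 * K * norm x"
proof -
  have "norm (X m) \<le> g m * norm x" by (rule X_norm)
  also have "\<dots> \<le> 3 * K * norm x" using g[of m] pos by (intro mult_right_mono) auto
  finally show ?thesis .
qed

text \<open>The factor 3 collects one \<open>K\<close> each from the solution, from the profile
  \<open>b\<close>, and from the discretisation error by the mesh condition
  \<open>\<eta>_le\<close>.\<close>

lemma norm_le_of_error:
  assumes "norm (a - X m) \<le> (b + \<eta> * exp (H * real m)) * norm x" "b \<le> K" "m \<le> F J"
  shows "norm a \<le> 3 * K * norm x" and "norm a \<le> (g m + b + \<eta> * exp \<Lambda>) * norm x"
proof -
  have *: "\<eta> * exp (H * real m) \<le> \<eta> * exp \<Lambda>"
    using exp_le_exp_horizon[OF assms(3)] \<eta>_nonneg by (rule mult_left_mono)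
  have "norm a \<le> norm (X m) + norm (a - X m)"
    by (rule norm_triangle_sub)
  also have "\<dots> \<le> g m * norm x + (b + \<eta> * exp (H * real m)) * norm x"
    by (intro add_mono X_norm assms)
  also have "\<dots> \<le> (g m + b + \<eta> * exp \<Lambda>) * norm x"
    unfolding distrib_right[symmetric] using * by (intro mult_right_mono) auto
  finally show 1: "norm a \<le> (g m + b + \<eta> * exp \<Lambda>) * norm x" .
  also have "\<dots> \<le> 3 * K * norm x"
    using g[of m] assms(2) \<eta>_le by (intro mult_right_mono) auto
  finally show "norm a \<le> 3 * K * norm x" .
qed

lemma picard_error_extend:
  assumes "\<And>m. m \<le> F j \<Longrightarrow> norm (z j x m - X m) \<le> (B j m + \<eta> * exp (H * real m)) * norm x"
  shows "norm (z j x m - X m) \<le> (B_ext j m + \<eta> * exp (H * real m)) * norm x"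
proof (cases "m \<le> F j")
  case False
  then have z: "z j x m = z j x (F j)"
    using F(1) by (intro picard_beyond_frontier) auto
  have "norm (z j x m - X m) \<le> norm (z j x (F j) - X (F j)) + norm (X (F j + (m - F j)) - X (F j))"
    unfolding z using False norm_triangle_ineq4[of "z j x (F j) - X (F j)" "X m - X (F j)"] by simp
  also have "\<dots> \<le> (B j (F j) + \<eta> * exp (H * real (F j))) * norm x
      + h * L * real (m - F j) * g (F j) * norm x"
    by (intro add_mono assms X_drift) simp
  also have "\<dots> = (B_ext j m + \<eta> * exp (H * real (F j))) * norm x"
    using False by (simp add: error_extension_def H_def algebra_simps)
  also have "\<dots> \<le> (B_ext j m + \<eta> * exp (H * real m)) * norm x"
    using False H_pos \<eta>_nonneg by (intro mult_right_mono add_left_mono mult_left_mono) auto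
  finally show ?thesis .
qed (simp add: error_extension_def assms)

text \<open>The new error is a sum of Lipschitz images of the old errors and of Euler errors of size
  \<open>H\<^sup>2 * K\<close>. Summing the exponential reproduces it minus 1, and the
  \<open>\<eta>\<close> thus gained equals the total \<open>H * K * \<Lambda>\<close> allowed for
  the Euler errors.\<close>

lemma picard_error:
  "j \<le> J \<Longrightarrow> m \<le> F j \<Longrightarrow> norm (z j x m - X m) \<le> (B j m + \<eta> * exp (H * real m)) * norm x"
proof (induction j arbitrary: m)
  case 0
  then show ?case using F(1) B_0 \<eta>_nonneg by (simp add: X_0)
next
  case (Suc j)
  have m: "m \<le> F J" using Suc.prems F_le[OF Suc.prems(1)] by simp
  have ext: "norm (z j x l - X l) \<le> (B_ext j l + \<eta> * exp (H * real l)) * norm x" for l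
    by (rule picard_error_extend) (use Suc in auto)
  \<comment> \<open>Summation up to the frontier of iterate \<open>j + 1\<close> reaches points
    beyond that of iterate \<open>j\<close>; the bound on the extended profile covers these
    too.\<close>
  have z_in: "norm (z j x l) \<le> 3 * K * norm x" if "l < m" for l
    by (rule norm_le_of_error(1)[OF ext]) (use that Suc.prems m in \<open>auto intro: B_ext_le\<close>)
  have "X m - x = (\<Sum>l<m. X (Suc l) - X l)"
    by (subst sum_lessThan_telescope) (simp add: X_0)
  moreover have "z (Suc j) x m - x = (\<Sum>l<m. h *\<^sub>R f (z j x l))"
    using Suc.prems by (simp add: min_absorb1 scaleR_sum_right)
  ultimately have "z (Suc j) x m - X m = (\<Sum>l<m. h *\<^sub>R f (z j x l) - (X (Suc l) - X l))"
    unfolding sum_subtractf by (metis diff_diff_eq2 diff_add_cancel)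
  also have "\<dots> = (\<Sum>l<m. h *\<^sub>R (f (z j x l) - f (X l)) - (X (Suc l) - X l - h *\<^sub>R f (X l)))"
    by (intro sum.cong) (auto simp: scaleR_diff_right)
  finally have eq: "z (Suc j) x m - X m = \<dots>" .
  have "norm (z (Suc j) x m - X m) \<le> (\<Sum>l<m. H * ((B_ext j l + \<eta> * exp (H * real l)) * norm x) + H\<^sup>2 * K * norm x)"
    unfolding eq
  proof (intro sum_norm_le)
    fix l assume l: "l \<in> {..<m}"
    have "norm (h *\<^sub>R (f (z j x l) - f (X l))) \<le> h * (L * norm (z j x l - X l))"
      using f_dist[OF z_in X_in] l pos by simp
    also have "\<dots> \<le> H * ((B_ext j l + \<eta> * exp (H * real l)) * norm x)"
      using mult_left_mono[OF ext[of l], of H] H_pos by (simp add: H_def mult_ac)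
    finally show "norm (h *\<^sub>R (f (z j x l) - f (X l)) - (X (Suc l) - X l - h *\<^sub>R f (X l)))
        \<le> H * ((B_ext j l + \<eta> * exp (H * real l)) * norm x) + H\<^sup>2 * K * norm x"
      using X_step[of l] norm_triangle_ineq4[of "h *\<^sub>R (f (z j x l) - f (X l))"
          "X (Suc l) - X l - h *\<^sub>R f (X l)"] unfolding H_def by linarith
  qed
  also have "\<dots> = (\<Sum>l<m. (H * B_ext j l + \<eta> * (H * exp (H * real l)) + H * K * H) * norm x)"
    by (intro sum.cong refl) (simp only: algebra_simps power2_eq_square)
  also have "\<dots> = (H * (\<Sum>l<m. B_ext j l) + \<eta> * (H * (\<Sum>l<m. exp (H * real l))) + real m * (H * K * H)) * norm x"
    by (simp add: sum.distrib flip: sum_distrib_left sum_distrib_right)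
  also have "\<dots> = (H * (\<Sum>l<m. B_ext j l) + \<eta> * (H * (\<Sum>l<m. exp (H * real l))) + H * K * (H * real m)) * norm x"
    by (simp only: mult_ac)
  also have "\<dots> \<le> (B (Suc j) m + \<eta> * (exp (H * real m) - 1) + H * K * \<Lambda>) * norm x"
  proof (intro mult_right_mono add_mono mult_left_mono sum_exp_le)
    show "H * (\<Sum>l<m. B_ext j l) \<le> B (Suc j) m"
      using Suc.prems by (intro B_ext_sum) auto
    show "H * real m \<le> \<Lambda>"
      using horizon m H_pos mult_left_mono[of "real m" "real (F J)" H] by (simp add: H_def)
  qed (use \<eta>_nonneg H_pos pos in auto)
  also have "\<dots> = (B (Suc j) m + \<eta> * exp (H * real m)) * norm x"
    by (simp add: \<eta>_def' algebra_simps)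
  finally show ?case .
qed

lemma picard_norm:
  assumes "j \<le> J" "m \<le> F j"
  shows "norm (z j x m) \<le> (g m + B j m + \<eta> * exp \<Lambda>) * norm x"
  using picard_error[OF assms] B_le[OF assms] assms F_le[of j]
  by (intro norm_le_of_error(2)) auto

lemma picard_in:
  assumes "j \<le> J"
  shows "norm (z j x m) \<le> 3 * K * norm x"
proof -
  have *: "norm (z j x m) \<le> 3 * K * norm x" if "m \<le> F j" for m
    using that F_le[OF assms]
    by (intro norm_le_of_error(1)[OF picard_error[OF assms that] B_le[OF assms that]]) simp
  then show ?thesis
    using picard_beyond_frontier[of F j m f h x] F(1) by (cases "m \<le> F j") auto
qed

section \<open>Defect between time derivative and derivative along the field\<close>

text \<open>
  Since the time difference quotient of the iterate \<open>i + 1\<close> is \<open>f\<close> evaluated at the iterate \<open>i\<close>, this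
  is \<open>\<partial>z/\<partial>t - \<psi>\<close>. It also makes sense at the frontier itself, where the difference quotient does not.
\<close>

definition defect :: "nat \<Rightarrow> nat \<Rightarrow> 'a" where
  "defect j m = (case j of 0 \<Rightarrow> 0 | Suc i \<Rightarrow> f (z i x m) - \<psi> j m)"

lemma picard_increment:
  assumes "j \<le> J"
  shows "norm (z j x (Suc l) - z j x l) \<le> 3 * H * K * norm x"
proof (cases "l < F j")
  case True
  then obtain i where j: "j = Suc i"
    using F(1) by (cases j) auto
  have "norm (z j x (Suc l) - z j x l) = h * norm (f (z i x l))"
    using True pos unfolding j by (subst picard_Suc_Suc) auto
  also have "\<dots> \<le> h * (L * (3 * K * norm x))"
    using f_norm[OF picard_in] picard_in assms pos j
    by (intro mult_left_mono order_trans[OF f_norm[OF picard_in]]) auto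
  finally show ?thesis by (simp add: H_def mult_ac)
next
  case False
  then have "z j x (Suc l) = z j x l"
    using F(1) picard_beyond_frontier[of F j] by (metis le_SucI linorder_not_le)
  then show ?thesis using H_pos pos by simp
qed

text \<open>Below the frontier the left side is \<open>h\<close> times the defect. Beyond it the
  iterate does not move, so all of \<open>h *\<^sub>R \<psi>\<close> remains, and
  \<open>\<psi>\<close> is bounded as \<open>f\<close> of the preceding iterate minus the defect,
  both taken at the frontier.\<close>

lemma defect_increment:
  assumes "Suc j \<le> J" "l < F (Suc j)"
    and D: "\<And>m. m \<le> F j \<Longrightarrow> norm (defect j m) \<le> L * ((W j m + \<theta> * exp (H * real m)) * norm x)"
  shows "norm (z j x (Suc l) - z j x l - h *\<^sub>R \<psi> j l)
    \<le> H * ((W_ext j l + \<theta> * exp (H * real l) + \<eta> * exp \<Lambda>) * norm x)"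
proof (cases "l < F j")
  case True
  then obtain i where j: "j = Suc i"
    using F(1) by (cases j) auto
  have "z j x (Suc l) - z j x l = h *\<^sub>R f (z i x l)"
    unfolding j using True j by (intro picard_Suc_Suc) simp
  then have "norm (z j x (Suc l) - z j x l - h *\<^sub>R \<psi> j l) = h * norm (defect j l)"
    using pos unfolding j by (simp add: defect_def flip: scaleR_diff_right)
  also have "\<dots> \<le> h * (L * ((W j l + \<theta> * exp (H * real l)) * norm x))"
    using True pos by (intro mult_left_mono D) auto
  also have "\<dots> \<le> h * (L * ((W_ext j l + \<theta> * exp (H * real l) + \<eta> * exp \<Lambda>) * norm x))"
    using True pos \<eta>_nonneg by (intro mult_left_mono mult_right_mono) (auto simp: defect_extension_def)
  finally show ?thesis by (simp add: H_def mult_ac)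
next
  case False
  then have "z j x (Suc l) - z j x l = 0" "\<psi> j l = \<psi> j (F j)"
    using F(1) picard_beyond_frontier[of F j] picard_deriv_beyond_frontier[of F j]
    by (metis diff_self le_SucI linorder_not_le, metis linorder_not_le)
  then have eq: "norm (z j x (Suc l) - z j x l - h *\<^sub>R \<psi> j l) = h * norm (\<psi> j (F j))"
    using pos by simp
  have "norm (\<psi> j (F j)) \<le> L * ((W_ext j l + \<theta> * exp (H * real l) + \<eta> * exp \<Lambda>) * norm x)"
  proof (cases j)
    case 0
    have "norm (f x) \<le> L * norm x"
      using X_in[of 0] by (intro f_norm) (simp add: X_0)
    also have "\<dots> \<le> L * ((W_ext j l + \<theta> * exp (H * real l) + \<eta> * exp \<Lambda>) * norm x)"
    proof -
      have "1 \<le> W_ext j l + \<theta> * exp (H * real l) + \<eta> * exp \<Lambda>"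
        using W_0 \<theta>_nonneg \<eta>_nonneg F(1) by (simp add: defect_extension_def 0)
      then show ?thesis
        using pos mult_right_mono[of 1 _ "norm x"] by (intro mult_left_mono) auto
    qed
    finally show ?thesis by (simp add: 0)
  next
    case (Suc i)
    \<comment> \<open>Iterate \<open>i\<close> is already constant from its own, earlier frontier
      on. This is why \<open>defect_extension\<close> evaluates \<open>g\<close> and
      \<open>B\<close> at \<open>F i\<close>.\<close>
    have z: "z i x (F j) = z i x (F i)"
      using F(1) F_Suc[of i] by (intro picard_beyond_frontier) (auto simp: Suc)
    have eq: "\<psi> j (F j) = f (z i x (F i)) - defect j (F j)"
      by (simp add: defect_def Suc flip: z)
    have "norm (\<psi> j (F j)) \<le> norm (f (z i x (F i))) + norm (defect j (F j))"
      unfolding eq by (rule norm_triangle_ineq4)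
    also have "\<dots> \<le> L * ((g (F i) + B i (F i) + \<eta> * exp \<Lambda>) * norm x)
        + L * ((W j (F j) + \<theta> * exp (H * real (F j))) * norm x)"
    proof (intro add_mono D)
      have "norm (f (z i x (F i))) \<le> L * norm (z i x (F i))"
        using assms(1) Suc by (intro f_norm picard_in) simp
      also have "\<dots> \<le> L * ((g (F i) + B i (F i) + \<eta> * exp \<Lambda>) * norm x)"
        using pos assms(1) Suc by (intro mult_left_mono picard_norm) auto
      finally show "norm (f (z i x (F i))) \<le> L * ((g (F i) + B i (F i) + \<eta> * exp \<Lambda>) * norm x)" .
    qed simp
    also have "\<dots> = L * ((W_ext j l + \<theta> * exp (H * real (F j)) + \<eta> * exp \<Lambda>) * norm x)"
      using False by (simp add: defect_extension_def Suc algebra_simps)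
    also have "\<dots> \<le> L * ((W_ext j l + \<theta> * exp (H * real l) + \<eta> * exp \<Lambda>) * norm x)"
      using False H_pos \<theta>_nonneg pos
      by (intro mult_left_mono mult_right_mono add_right_mono add_left_mono) auto
    finally show ?thesis .
  qed
  then have "h * norm (\<psi> j (F j)) \<le> h * (L * ((W_ext j l + \<theta> * exp (H * real l) + \<eta> * exp \<Lambda>) * norm x))"
    using pos by (intro mult_left_mono) auto
  then show ?thesis unfolding eq by (simp add: H_def mult_ac)
qed

text \<open>Telescoping \<open>f\<close> along the iterate and expanding each step gives Taylor
  remainders plus \<open>f'\<close> applied to the differences of \<open>defect_increment\<close>.
  As in \<open>picard_error\<close>, the \<open>- 1\<close> from summing the exponential pays for
  the mesh terms; this fixes \<open>\<theta>\<close>, with 9 coming from the squared increment bound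
  \<open>3 * H * K * norm x\<close>.\<close>

lemma defect_bound:
  "j \<le> J \<Longrightarrow> m \<le> F j \<Longrightarrow> norm (defect j m) \<le> L * ((W j m + \<theta> * exp (H * real m)) * norm x)"
proof (induction j arbitrary: m)
  case 0
  then show ?case using F(1) W_0 \<theta>_nonneg pos by (simp add: defect_def)
next
  case (Suc j)
  have m: "m \<le> F J" using Suc.prems F_le[OF Suc.prems(1)] by simp
  let ?z = "z j x" and ?W = "\<lambda>l. (W_ext j l + \<theta> * exp (H * real l) + \<eta> * exp \<Lambda>) * norm x"
  let ?\<rho> = "\<lambda>l. f (?z (Suc l)) - f (?z l) - f' (?z l) (?z (Suc l) - ?z l)"
  let ?d = "\<lambda>l. ?z (Suc l) - ?z l - h *\<^sub>R \<psi> j l"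
  have lin: "linear (f' a)" for a
    using has_derivative_linear[OF f'] .
  have "f (?z m) - f x = (\<Sum>l<m. f (?z (Suc l)) - f (?z l))"
    by (subst sum_lessThan_telescope) simp
  moreover have "defect (Suc j) m = (f (?z m) - f x) - (\<Sum>l<m. h *\<^sub>R f' (?z l) (\<psi> j l))"
    using Suc.prems by (simp add: defect_def min_absorb1 scaleR_sum_right)
  ultimately have "defect (Suc j) m = (\<Sum>l<m. f (?z (Suc l)) - f (?z l) - h *\<^sub>R f' (?z l) (\<psi> j l))"
    by (simp only: sum_subtractf)
  also have "\<dots> = (\<Sum>l<m. ?\<rho> l + f' (?z l) (?d l))"
    using lin by (simp add: linear_diff linear_scale)
  finally have eq: "defect (Suc j) m = \<dots>" .
  have "norm (defect (Suc j) m) \<le> (\<Sum>l<m. C * (3 * H * K * norm x)\<^sup>2 + L * (H * ?W l))"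
    unfolding eq
  proof (intro sum_norm_le norm_triangle_le add_mono)
    fix l assume l: "l \<in> {..<m}"
    have "norm (?\<rho> l) \<le> C * (norm (?z (Suc l) - ?z l))\<^sup>2"
      using Suc.prems by (intro remainder in_cball picard_in) simp_all
    also have "\<dots> \<le> C * (3 * H * K * norm x)\<^sup>2"
      using picard_increment[of j l] Suc.prems pos by (intro mult_left_mono power_mono) auto
    finally show "norm (?\<rho> l) \<le> C * (3 * H * K * norm x)\<^sup>2" .
    have "norm (f' (?z l) (?d l)) \<le> L * norm (?d l)"
      using Suc.prems by (intro f'_bound picard_in) simp
    also have "\<dots> \<le> L * (H * ?W l)"
      using Suc l pos by (intro mult_left_mono defect_increment) auto
    finally show "norm (f' (?z l) (?d l)) \<le> L * (H * ?W l)" .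
  qed
  also have "\<dots> = (\<Sum>l<m. L * ((H * W_ext j l + \<theta> * (H * exp (H * real l)) + H * (\<eta> * exp \<Lambda>)) * norm x)
      + H * (9 * H * C * K\<^sup>2 * (norm x * norm x)))"
    by (intro sum.cong refl) (simp add: algebra_simps power2_eq_square)
  also have "\<dots> = L * ((H * (\<Sum>l<m. W_ext j l) + \<theta> * (H * (\<Sum>l<m. exp (H * real l)))
      + real m * (H * (\<eta> * exp \<Lambda>))) * norm x) + real m * (H * (9 * H * C * K\<^sup>2 * (norm x * norm x)))"
    by (simp add: sum.distrib flip: sum_distrib_left sum_distrib_right)
  also have "\<dots> = L * ((H * (\<Sum>l<m. W_ext j l) + \<theta> * (H * (\<Sum>l<m. exp (H * real l)))
      + H * real m * (\<eta> * exp \<Lambda>)) * norm x) + H * real m * (9 * H * C * K\<^sup>2 * (norm x * norm x))"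
    by (simp only: mult_ac)
  also have "\<dots> \<le> L * ((W (Suc j) m + \<theta> * (exp (H * real m) - 1) + \<Lambda> * (\<eta> * exp \<Lambda>)) * norm x)
      + \<Lambda> * (9 * H * C * K\<^sup>2 * (r * norm x))"
  proof (intro mult_right_mono add_mono mult_left_mono sum_exp_le mult_mono)
    show "H * (\<Sum>l<m. W_ext j l) \<le> W (Suc j) m"
      using Suc.prems by (intro W_ext_sum) auto
    show "H * real m \<le> \<Lambda>" "H * real m \<le> \<Lambda>"
      using horizon m H_pos mult_left_mono[of "real m" "real (F J)" H] by (simp_all add: H_def)
  qed (use \<eta>_nonneg \<theta>_nonneg H_pos pos x in auto)
  also have "\<dots> = L * ((W (Suc j) m + \<theta> * exp (H * real m)) * norm x)"
    using pos by (simp add: \<theta>_def' field_simps)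
  finally show ?case .
qed

section \<open>Lyapunov estimates along one trajectory\<close>

text \<open>Replacing \<open>h *\<^sub>R \<psi>\<close> by the increment of the iterate minus
  \<open>h\<close> times the defect leaves \<open>2 * (a \<bullet> (b - a))\<close>, which is at
  most the increment of the squared norm. These increments telescope, and the defect is estimated by
  Cauchy-Schwarz.\<close>

lemma gradient_lyapunov_bound:
  assumes "J \<ge> 1" and W: "\<And>m. m \<le> F J \<Longrightarrow> 0 \<le> W J m"
  shows "gradient (picard_lyapunov f h F J (F J)) x \<bullet> f x \<le>
    ((g (F J) + B J (F J) + \<eta> * exp \<Lambda>)\<^sup>2 - 1 +
      2 * (H * (\<Sum>m<F J. (g m + B J m + \<eta> * exp \<Lambda>) * (W J m + \<theta> * exp \<Lambda>)))) * (norm x)\<^sup>2"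
proof -
  obtain i where J: "J = Suc i"
    using assms(1) by (cases J) auto
  let ?U = "\<lambda>m. g m + B J m + \<eta> * exp \<Lambda>" and ?D = "\<lambda>m. W J m + \<theta> * exp \<Lambda>"
  have step: "h * (2 * (z J x m \<bullet> \<psi> J m)) \<le>
      ((norm (z J x (Suc m)))\<^sup>2 - (norm (z J x m))\<^sup>2) + 2 * (H * (?U m * ?D m)) * (norm x)\<^sup>2"
    if "m < F J" for m
  proof -
    let ?a = "z J x m" and ?b = "z J x (Suc m)"
    have "?b - ?a = h *\<^sub>R f (z i x m)"
      using that unfolding J by (rule picard_Suc_Suc)
    then have \<psi>: "h *\<^sub>R \<psi> J m = (?b - ?a) - h *\<^sub>R defect J m"
      by (simp add: defect_def J scaleR_diff_right)
    have D: "norm (defect J m) \<le> L * (?D m * norm x)"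
    proof -
      have "norm (defect J m) \<le> L * ((W J m + \<theta> * exp (H * real m)) * norm x)"
        using that by (intro defect_bound) auto
      also have "\<dots> \<le> L * (?D m * norm x)"
        using pos \<theta>_nonneg that
        by (intro mult_left_mono mult_right_mono add_left_mono exp_le_exp_horizon) auto
      finally show ?thesis .
    qed
    have "- (?a \<bullet> defect J m) \<le> norm ?a * norm (defect J m)"
      using norm_cauchy_schwarz[of ?a "- defect J m"] by simp
    also have "\<dots> \<le> (?U m * norm x) * (L * (?D m * norm x))"
      using that D by (intro mult_mono picard_norm) (auto intro: order_trans[OF norm_ge_zero picard_norm[of J m]])
    finally have 1: "- (?a \<bullet> defect J m) \<le> (?U m * norm x) * (L * (?D m * norm x))" .
    have "h * (2 * (?a \<bullet> \<psi> J m)) = 2 * (?a \<bullet> (h *\<^sub>R \<psi> J m))"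
      by simp
    also have "\<dots> = 2 * (?a \<bullet> (?b - ?a)) + 2 * h * (- (?a \<bullet> defect J m))"
      unfolding \<psi> by (simp add: inner_diff_right)
    finally have 2: "h * (2 * (?a \<bullet> \<psi> J m)) = 2 * (?a \<bullet> (?b - ?a)) + 2 * h * (- (?a \<bullet> defect J m))" .
    have 3: "2 * (?a \<bullet> (?b - ?a)) \<le> (norm ?b)\<^sup>2 - (norm ?a)\<^sup>2"
      using inner_ge_zero[of "?b - ?a"]
      by (simp add: power2_norm_eq_inner inner_diff_left inner_diff_right inner_commute)
    have "2 * h * (- (?a \<bullet> defect J m)) \<le> 2 * h * ((?U m * norm x) * (L * (?D m * norm x)))"
      using 1 pos by (intro mult_left_mono) auto
    also have "\<dots> = 2 * (H * (?U m * ?D m)) * (norm x)\<^sup>2"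
      by (simp only: H_def power2_eq_square mult_ac)
    finally show ?thesis
      using 2 3 by linarith
  qed
  have "gradient (picard_lyapunov f h F J (F J)) x \<bullet> f x = (\<Sum>m<F J. h * (2 * (z J x m \<bullet> \<psi> J m)))"
    by (simp add: gradient_picard_lyapunov[OF f'] sum_distrib_left)
  also have "\<dots> \<le> (\<Sum>m<F J. ((norm (z J x (Suc m)))\<^sup>2 - (norm (z J x m))\<^sup>2)
      + 2 * (H * (?U m * ?D m)) * (norm x)\<^sup>2)"
    using step by (intro sum_mono) auto
  also have "\<dots> = (norm (z J x (F J)))\<^sup>2 - (norm x)\<^sup>2
      + 2 * (H * (\<Sum>m<F J. ?U m * ?D m)) * (norm x)\<^sup>2"
    using sum_lessThan_telescope[of "\<lambda>m. (norm (z J x m))\<^sup>2" "F J"]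
    by (simp add: sum.distrib sum_distrib_left sum_distrib_right)
  also have "\<dots> \<le> (?U (F J) * norm x)\<^sup>2 - (norm x)\<^sup>2 + 2 * (H * (\<Sum>m<F J. ?U m * ?D m)) * (norm x)\<^sup>2"
    by (intro add_right_mono diff_right_mono power_mono picard_norm) auto
  also have "\<dots> = ((?U (F J))\<^sup>2 - 1 + 2 * (H * (\<Sum>m<F J. ?U m * ?D m))) * (norm x)\<^sup>2"
    unfolding power_mult_distrib[of _ "norm x"] by (simp only: left_diff_distrib distrib_right mult_1)
  finally show ?thesis .
qed

text \<open>Separates the part \<open>A\<close>, determined by the profiles, from terms that each
  carry a factor \<open>\<eta>\<close> or \<open>\<theta>\<close> and so vanish as the mesh is
  refined.\<close>

lemma gradient_lyapunov_le:
  assumes J: "J \<ge> 1" and B: "\<And>m. m \<le> F J \<Longrightarrow> 0 \<le> B J m"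
    and W: "\<And>m. m \<le> F J \<Longrightarrow> 0 \<le> W J m \<and> W J m \<le> P"
    and A: "(g (F J) + B J (F J))\<^sup>2 + 2 * (H * (\<Sum>m<F J. (g m + B J m) * W J m)) \<le> A"
  shows "gradient (picard_lyapunov f h F J (F J)) x \<bullet> f x \<le>
    (A - 1 + \<eta> * exp \<Lambda> * (4 * K + \<eta> * exp \<Lambda>) + 2 * (\<Lambda> * (2 * K * (\<theta> * exp \<Lambda>)
      + \<eta> * exp \<Lambda> * P + \<eta> * exp \<Lambda> * (\<theta> * exp \<Lambda>)))) * (norm x)\<^sup>2"
proof -
  let ?e = "\<eta> * exp \<Lambda>" and ?d = "\<theta> * exp \<Lambda>" and ?U = "\<lambda>m. g m + B J m"
  have nonneg: "0 \<le> ?e" "0 \<le> ?d"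
    using \<eta>_nonneg \<theta>_nonneg by auto
  have U: "0 \<le> ?U m" "?U m \<le> 2 * K" if "m \<le> F J" for m
    using g[of m] B[OF that] B_le[of J m] that by auto
  have "(?U m + ?e) * (W J m + ?d) \<le> ?U m * W J m + (2 * K * ?d + ?e * P + ?e * ?d)" if "m < F J" for m
  proof -
    have "?U m * ?d \<le> 2 * K * ?d" "?e * W J m \<le> ?e * P"
      using U[of m] W[of m] that nonneg by (auto intro: mult_right_mono mult_left_mono)
    then show ?thesis by (simp only: distrib_left distrib_right)
  qed
  then have "(\<Sum>m<F J. (?U m + ?e) * (W J m + ?d)) \<le>
      (\<Sum>m<F J. ?U m * W J m + (2 * K * ?d + ?e * P + ?e * ?d))"
    by (intro sum_mono) auto
  also have "\<dots> = (\<Sum>m<F J. ?U m * W J m) + real (F J) * (2 * K * ?d + ?e * P + ?e * ?d)"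
    by (simp add: sum.distrib)
  finally have "H * (\<Sum>m<F J. (?U m + ?e) * (W J m + ?d)) \<le>
      H * ((\<Sum>m<F J. ?U m * W J m) + real (F J) * (2 * K * ?d + ?e * P + ?e * ?d))"
    using H_pos by (intro mult_left_mono) auto
  also have "\<dots> = H * (\<Sum>m<F J. ?U m * W J m) + H * real (F J) * (2 * K * ?d + ?e * P + ?e * ?d)"
    by (simp only: distrib_left mult.assoc)
  also have "\<dots> \<le> H * (\<Sum>m<F J. ?U m * W J m) + \<Lambda> * (2 * K * ?d + ?e * P + ?e * ?d)"
  proof -
    have "P \<ge> 0" using W[of 0] by simp
    then show ?thesis
      using horizon pos nonneg by (intro add_left_mono mult_right_mono) (auto simp: H_def)
  qed
  finally have 1: "H * (\<Sum>m<F J. (?U m + ?e) * (W J m + ?d)) \<le>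
      H * (\<Sum>m<F J. ?U m * W J m) + \<Lambda> * (2 * K * ?d + ?e * P + ?e * ?d)" .
  have "(?U (F J) + ?e)\<^sup>2 = (?U (F J))\<^sup>2 + ?e * (2 * ?U (F J) + ?e)"
    by (simp add: power2_eq_square algebra_simps)
  also have "\<dots> \<le> (?U (F J))\<^sup>2 + ?e * (4 * K + ?e)"
    using U[of "F J"] nonneg by (intro add_left_mono mult_left_mono) auto
  finally have 2: "(?U (F J) + ?e)\<^sup>2 \<le> (?U (F J))\<^sup>2 + ?e * (4 * K + ?e)" .
  have "(?U (F J) + ?e)\<^sup>2 - 1 + 2 * (H * (\<Sum>m<F J. (?U m + ?e) * (W J m + ?d))) \<le>
      A - 1 + ?e * (4 * K + ?e) + 2 * (\<Lambda> * (2 * K * ?d + ?e * P + ?e * ?d))"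
    using 1 2 A by linarith
  then show ?thesis
    using W by (intro order_trans[OF gradient_lyapunov_bound[OF J]] mult_right_mono) auto
qed

text \<open>The lower bound needs only the summand at time 0, where every iterate equals
  \<open>x\<close>; the upper bound uses \<open>picard_in\<close> in each summand.\<close>

lemma lyapunov_bounds:
  assumes "F J \<ge> 1"
  shows "h * (norm x)\<^sup>2 \<le> picard_lyapunov f h F J (F J) x"
    and "picard_lyapunov f h F J (F J) x \<le> 9 * K\<^sup>2 * h * real (F J) * (norm x)\<^sup>2"
proof -
  have "(norm (z J x 0))\<^sup>2 \<le> (\<Sum>m<F J. (norm (z J x m))\<^sup>2)"
    using assms by (intro member_le_sum) auto
  then show "h * (norm x)\<^sup>2 \<le> picard_lyapunov f h F J (F J) x"
    using pos by (simp add: picard_lyapunov_def)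
  have "(\<Sum>m<F J. (norm (z J x m))\<^sup>2) \<le> (\<Sum>m<F J. (3 * K * norm x)\<^sup>2)"
    by (intro sum_mono power_mono picard_in) auto
  then have "picard_lyapunov f h F J (F J) x \<le> h * (\<Sum>m<F J. (3 * K * norm x)\<^sup>2)"
    unfolding picard_lyapunov_def using pos by (intro mult_left_mono) auto
  then show "picard_lyapunov f h F J (F J) x \<le> 9 * K\<^sup>2 * h * real (F J) * (norm x)\<^sup>2"
    by (simp add: power_mult_distrib mult_ac)
qed

end

section \<open>From supersolutions to Lyapunov functions\<close>

lemma vector_derivative_increment_bound:
  fixes y :: "real \<Rightarrow> 'a::real_normed_vector"
  assumes "a \<le> b"
    and "\<And>t. t \<in> {a..b} \<Longrightarrow> (y has_vector_derivative y' t) (at t within {a..b})"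
    and "\<And>t. t \<in> {a..b} \<Longrightarrow> norm (y' t) \<le> D"
  shows "norm (y b - y a) \<le> (b - a) * D"
proof -
  have "norm (y b - y a) \<le> D * norm (b - a)"
  proof (rule differentiable_bound)
    show "onorm (\<lambda>s. s *\<^sub>R y' t) \<le> D" if "t \<in> {a..b}" for t
    proof (rule onorm_le)
      show "norm (s *\<^sub>R y' t) \<le> D * norm s" for s
        using mult_left_mono[OF assms(3)[OF that], of "\<bar>s\<bar>"] by (simp add: mult.commute)
    qed
  qed (use assms in \<open>auto simp: has_vector_derivative_def\<close>)
  then show ?thesis using assms(1) by (simp add: mult.commute)
qed

section \<open>Estimates along one decaying solution\<close>

locale decaying_solution =
  fixes f :: "'a::real_inner \<Rightarrow> 'a" and L K r lam :: real and x0 :: 'a and x :: "real \<Rightarrow> 'a"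
  assumes f_zero: "f 0 = 0"
    and lipschitz: "L-lipschitz_on (cball 0 (4 * K * r)) f"
    and pos: "K \<ge> 1" "lam > 0" "L > 0"
    and x0: "norm x0 \<le> r" and x_0: "x 0 = x0"
    and sol: "\<And>t. t \<ge> 0 \<Longrightarrow> (x has_vector_derivative f (x t)) (at t within {0..})"
    and decay: "\<And>t. t \<ge> 0 \<Longrightarrow> norm (x t) \<le> K * norm x0 * exp (- lam * t)"
begin

lemma in_ball: "t \<ge> 0 \<Longrightarrow> x t \<in> cball 0 (4 * K * r)"
proof -
  assume t: "t \<ge> 0"
  have "norm (x t) \<le> K * norm x0 * exp (- lam * t)" by (rule decay[OF t])
  also have "\<dots> \<le> K * norm x0 * 1"
    using t pos by (intro mult_left_mono) auto
  also have "\<dots> \<le> 4 * K * r"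
    using x0 pos mult_mono[of K "4 * K" "norm x0" r] by simp
  finally show ?thesis by simp
qed

lemma f_dist: "s \<ge> 0 \<Longrightarrow> t \<ge> 0 \<Longrightarrow> norm (f (x t) - f (x s)) \<le> L * norm (x t - x s)"
  using lipschitz_onD[OF lipschitz in_ball in_ball] by (simp add: dist_norm)

lemma f_norm: "t \<ge> 0 \<Longrightarrow> norm (f (x t)) \<le> L * norm (x t)"
proof -
  assume t: "t \<ge> 0"
  have "0 \<le> norm x0" by simp
  also have "\<dots> \<le> r" by (rule x0)
  finally have "0 \<in> cball 0 (4 * K * r)" using pos by simp
  from lipschitz_onD[OF lipschitz in_ball[OF t] this] show ?thesis
    by (simp add: f_zero)
qed

lemma sol_within: "0 \<le> s \<Longrightarrow> u \<in> {s..t} \<Longrightarrow> (x has_vector_derivative f (x u)) (at u within {s..t})"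
  by (rule has_vector_derivative_within_subset[OF sol]) auto

lemma drift:
  assumes "0 \<le> s" "s \<le> t"
  shows "norm (x t - x s) \<le> (t - s) * (L * (K * norm x0 * exp (- lam * s)))"
proof (rule vector_derivative_increment_bound)
  fix u assume u: "u \<in> {s..t}"
  show "(x has_vector_derivative f (x u)) (at u within {s..t})"
    using assms u by (intro sol_within)
  have "norm (f (x u)) \<le> L * norm (x u)"
    using assms u by (intro f_norm) auto
  also have "\<dots> \<le> L * (K * norm x0 * exp (- lam * u))"
    using assms u pos by (intro mult_left_mono decay) auto
  also have "\<dots> \<le> L * (K * norm x0 * exp (- lam * s))"
    using u pos by (intro mult_left_mono) auto
  finally show "norm (f (x u)) \<le> L * (K * norm x0 * exp (- lam * s))" .
qed (use assms in auto)

text \<open>After subtracting the linear motion with velocity \<open>f (x s)\<close>, the derivative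
  is \<open>f (x u) - f (x s)\<close>, which the Lipschitz bound and \<open>drift\<close> make of
  order \<open>h\<close>.\<close>

lemma euler_step:
  assumes "0 \<le> s" "0 \<le> h"
  shows "norm (x (s + h) - x s - h *\<^sub>R f (x s)) \<le> (h * L)\<^sup>2 * K * norm x0"
proof -
  let ?D = "h * L\<^sup>2 * K * norm x0"
  have "norm ((x (s + h) - (s + h) *\<^sub>R f (x s)) - (x s - s *\<^sub>R f (x s))) \<le> (s + h - s) * ?D"
  proof (rule vector_derivative_increment_bound)
    fix u assume u: "u \<in> {s..s + h}"
    show "((\<lambda>u. x u - u *\<^sub>R f (x s)) has_vector_derivative (f (x u) - f (x s))) (at u within {s..s + h})"
      using sol_within[OF assms(1) u] by (auto intro!: derivative_eq_intros)
    have "norm (f (x u) - f (x s)) \<le> L * norm (x u - x s)"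
      using assms u by (intro f_dist) auto
    also have "\<dots> \<le> L * ((u - s) * (L * (K * norm x0 * exp (- lam * s))))"
      using assms u pos by (intro mult_left_mono drift) auto
    also have "\<dots> \<le> L * (h * (L * (K * norm x0 * 1)))"
      using assms u pos by (intro mult_left_mono mult_mono) auto
    finally show "norm (f (x u) - f (x s)) \<le> ?D"
      by (simp add: power2_eq_square mult_ac)
  qed (use assms in auto)
  then show ?thesis
    by (simp add: algebra_simps power2_eq_square)
qed

text \<open>Since \<open>x \<bullet> f x\<close> is at least \<open>- L\<close> times the squared
  norm, the squared norm times \<open>exp (2 * L * t)\<close> cannot decrease.\<close>

lemma norm_lower_bound:
  assumes "t \<ge> 0"
  shows "norm x0 \<le> norm (x t) * exp (L * t)"
proof -
  let ?\<phi> = "\<lambda>t. (x t \<bullet> x t) * exp (2 * L * t)"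
  have "?\<phi> 0 \<le> ?\<phi> t"
  proof (rule DERIV_nonneg_imp_increasing_open[OF assms])
    fix u :: real assume u: "0 < u" "u < t"
    have "(x has_vector_derivative f (x u)) (at u)"
      using has_vector_derivative_within_subset[OF sol, of u "{0<..}"] u
        at_within_open[of u "{0<..}"] by (auto simp: subset_eq)
    then have "((\<lambda>t. x t \<bullet> x t) has_vector_derivative (x u \<bullet> f (x u) + f (x u) \<bullet> x u)) (at u)"
      by (intro bounded_bilinear.has_vector_derivative[OF bounded_bilinear_inner])
    then have "((\<lambda>t. x t \<bullet> x t) has_real_derivative 2 * (x u \<bullet> f (x u))) (at u)"
      by (simp add: has_real_derivative_iff_has_vector_derivative inner_commute)
    then have "(?\<phi> has_real_derivative
        2 * (x u \<bullet> f (x u) + L * (x u \<bullet> x u)) * exp (2 * L * u)) (at u)"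
      by (auto intro!: derivative_eq_intros simp: algebra_simps)
    moreover have "- (x u \<bullet> f (x u)) \<le> L * (x u \<bullet> x u)"
    proof -
      have "- (x u \<bullet> f (x u)) \<le> norm (x u) * norm (f (x u))"
        using norm_cauchy_schwarz[of "x u" "- f (x u)"] by simp
      also have "\<dots> \<le> norm (x u) * (L * norm (x u))"
        using u by (intro mult_left_mono f_norm) auto
      finally show ?thesis
        by (simp add: power2_norm_eq_inner[symmetric] power2_eq_square mult_ac)
    qed
    ultimately show "\<exists>y. (?\<phi> has_real_derivative y) (at u) \<and> 0 \<le> y"
      by (intro exI conjI) auto
  next
    have "continuous_on {0..} x"
      using sol has_vector_derivative_continuous by (fastforce simp: continuous_on_eq_continuous_within)
    then have "continuous_on {0..t} x"
      by (rule continuous_on_subset) auto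
    then show "continuous_on {0..t} ?\<phi>"
      by (intro continuous_intros)
  qed
  then have "(norm x0)\<^sup>2 \<le> (norm (x t) * exp (L * t))\<^sup>2"
    by (simp add: x_0 power2_norm_eq_inner[symmetric] power_mult_distrib mult_ac flip: exp_double)
  then show ?thesis
    by (rule power2_le_imp_le) simp
qed

text \<open>A nonzero solution decays at most at rate \<open>L\<close>, so the assumed rate
  \<open>lam\<close> cannot exceed \<open>L\<close>.\<close>

lemma decay_rate_le:
  assumes "x0 \<noteq> 0"
  shows "lam \<le> L"
proof (rule ccontr)
  assume "\<not> lam \<le> L"
  then have "lam > L" by simp
  \<comment> \<open>At this time the lower and upper bounds combine to
    \<open>1 \<le> K * exp (- K)\<close>, which is false for every \<open>K\<close>.\<close>
  define t where "t = K / (lam - L)"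
  have t: "t \<ge> 0" "(lam - L) * t = K"
    using pos \<open>lam > L\<close> by (auto simp: t_def)
  have "norm x0 \<le> norm (x t) * exp (L * t)"
    by (rule norm_lower_bound[OF t(1)])
  also have "\<dots> \<le> (K * norm x0 * exp (- lam * t)) * exp (L * t)"
    by (intro mult_right_mono decay t) auto
  also have "\<dots> = norm x0 * (K * exp (- K))"
    using t(2) by (simp add: mult_ac algebra_simps flip: exp_add)
  finally have "1 \<le> K * exp (- K)"
    using assms by (simp add: mult_le_cancel_left1)
  moreover have "K < exp K"
    using exp_ge_add_one_self[of K] by linarith
  ultimately show False
    by (simp add: exp_minus field_simps)
qed

end

section \<open>Mesh refinement for the whole region\<close>

locale decaying_polynomial_field =
  fixes f :: "real ^ 'n::finite \<Rightarrow> real ^ 'n" and M :: "(real ^ 'n) set"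
    and q :: nat and r lam K L :: real
  assumes f_poly: "polynomial_function f"
    and f_degree: "\<And>i. total_degree_le q (\<lambda>x. f x $ i)" "q \<ge> 1"
    and f_zero: "f 0 = 0"
    and pos: "r > 0" "lam > 0" "K \<ge> 1" "L > 0"
    and M: "M \<subseteq> cball 0 r"
    and decay: "\<forall>x0\<in>M. \<exists>x. x 0 = x0 \<and> (\<forall>t\<ge>0. (x has_vector_derivative f (x t)) (at t within {0..})) \<and>
                  (\<forall>t\<ge>0. norm (x t) \<le> K * norm x0 * exp (- lam * t))"
    and lipschitz: "L-lipschitz_on (cball 0 (4 * K * r)) f"
begin

definition sos_lyapunov :: "nat \<Rightarrow> bool" where
  "sos_lyapunov d \<longleftrightarrow> (\<exists>\<alpha> \<beta> \<gamma> :: real. \<exists>V :: real ^ 'n \<Rightarrow> real.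
    \<alpha> > 0 \<and> \<beta> > 0 \<and> \<gamma> > 0 \<and> sum_of_squares V \<and> poly_fun_degree V \<le> d \<and>
    (\<forall>x\<in>M. \<alpha> * (norm x)\<^sup>2 \<le> V x \<and> V x \<le> \<beta> * (norm x)\<^sup>2 \<and>
           gradient V x \<bullet> f x \<le> - \<gamma> * (norm x)\<^sup>2))"

lemma solution:
  assumes "x0 \<in> M"
  obtains x where "decaying_solution f L K r lam x0 x"
proof -
  obtain x where "x 0 = x0" "\<And>t. t \<ge> 0 \<Longrightarrow> (x has_vector_derivative f (x t)) (at t within {0..})"
    "\<And>t. t \<ge> 0 \<Longrightarrow> norm (x t) \<le> K * norm x0 * exp (- lam * t)"
    using decay assms by blast
  then have "decaying_solution f L K r lam x0 x"
    by unfold_locales (use assms M pos f_zero lipschitz in auto)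
  then show thesis by (rule that)
qed

text \<open>The bound \<open>A < 1\<close> is uniform in \<open>n\<close> while the discretisation
  terms tend to 0, so some \<open>n\<close> makes them smaller than half the gap
  \<open>1 - A\<close>. Neither profiles nor mesh depend on the initial point, so one
  \<open>V\<close> serves all of \<open>M\<close>.\<close>

lemma sos_lyapunov_from_profiles:
  assumes \<delta>: "\<delta> > 0" and J: "J \<ge> 1" and A: "A < 1"
    and F: "\<And>n. F n 0 = 0" "\<And>n. mono (F n)" "\<And>n. F n J \<ge> n"
    and h_def: "\<And>n. h n = \<delta> / real (F n J)"
    and g_def: "\<And>n m. g n m = K * exp (- lam * (h n * real m))"
    and profiles: "\<And>n. n \<ge> 1 \<Longrightarrow> admissible_profiles (h n * L) K (F n) J (g n) (B n) (W n)"
    and nonneg: "\<And>n m. n \<ge> 1 \<Longrightarrow> m \<le> F n J \<Longrightarrow> 0 \<le> B n J m \<and> 0 \<le> W n J m \<and> W n J m \<le> P"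
    and final: "\<And>n. n \<ge> 1 \<Longrightarrow> (g n (F n J) + B n J (F n J))\<^sup>2 +
      2 * (h n * L * (\<Sum>m<F n J. (g n m + B n J m) * W n J m)) \<le> A"
  shows "sos_lyapunov (2 * q ^ J)"
proof -
  have "4 * K * r \<ge> 0" using pos by simp
  then obtain f' C where C: "C \<ge> 0" "\<And>a. (f has_derivative f' a) (at a)"
    "\<And>a b. a \<in> cball 0 (4 * K * r) \<Longrightarrow> b \<in> cball 0 (4 * K * r) \<Longrightarrow>
      norm (f b - f a - f' a (b - a)) \<le> C * (norm (b - a))\<^sup>2"
    using polynomial_quadratic_remainder[OF f_poly] by metis
  define \<Lambda> where "\<Lambda> = \<delta> * L"
  define e where "e n = error_rate (h n * L) \<Lambda> K * exp \<Lambda>" for n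
  define d where "d n = defect_rate (h n * L) \<Lambda> K C r L * exp \<Lambda>" for n
  have h0: "h \<longlonglongrightarrow> 0"
  proof (rule tendsto_sandwich)
    show "\<forall>\<^sub>F n in sequentially. 0 \<le> h n"
      using \<delta> by (simp add: h_def)
    have "h n \<le> \<delta> / real n" if "n \<ge> 1" for n
      using \<delta> F(3)[of n] that by (simp add: h_def frac_le)
    then show "\<forall>\<^sub>F n in sequentially. h n \<le> \<delta> / real n"
      by (auto simp: eventually_sequentially)
    show "(\<lambda>n. \<delta> / real n) \<longlonglongrightarrow> 0"
      by (rule lim_const_over_n)
  qed simp
  have e0: "e \<longlonglongrightarrow> 0"
    unfolding e_def error_rate_def by (rule tendsto_eq_intros h0 refl | simp)+
  have d0: "d \<longlonglongrightarrow> 0"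
    unfolding d_def defect_rate_def error_rate_def using pos
    by (auto intro!: tendsto_eq_intros h0)
  have "(\<lambda>n. e n * (4 * K + e n) + 2 * (\<Lambda> * (2 * K * d n + e n * P + e n * d n))) \<longlonglongrightarrow> 0"
    by (auto intro!: tendsto_eq_intros e0 d0)
  then have "\<forall>\<^sub>F n in sequentially.
      e n * (4 * K + e n) + 2 * (\<Lambda> * (2 * K * d n + e n * P + e n * d n)) < (1 - A) / 2"
    using A by (intro order_tendstoD) auto
  moreover have "\<forall>\<^sub>F n in sequentially. e n < K"
    using e0 pos by (intro order_tendstoD) auto
  ultimately have "\<forall>\<^sub>F n in sequentially. n \<ge> 1 \<and> e n < K \<and>
      e n * (4 * K + e n) + 2 * (\<Lambda> * (2 * K * d n + e n * P + e n * d n)) < (1 - A) / 2"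
    using eventually_ge_at_top[of "1::nat"] by eventually_elim auto
  then obtain n where n: "n \<ge> 1" "e n < K"
    "e n * (4 * K + e n) + 2 * (\<Lambda> * (2 * K * d n + e n * P + e n * d n)) < (1 - A) / 2"
    using eventually_happens sequentially_bot by blast
  have h: "h n > 0" and F1: "F n J \<ge> 1"
    using F(3)[of n] n(1) \<delta> by (auto simp: h_def)
  let ?V = "picard_lyapunov f (h n) (F n) J (F n J)"
  have *: "h n * (norm x0)\<^sup>2 \<le> ?V x0 \<and> ?V x0 \<le> 9 * K\<^sup>2 * h n * real (F n J) * (norm x0)\<^sup>2 \<and>
      gradient ?V x0 \<bullet> f x0 \<le> - ((1 - A) / 2) * (norm x0)\<^sup>2" if x0: "x0 \<in> M" for x0
  proof -
    obtain x where "decaying_solution f L K r lam x0 x"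
      using x0 by (rule solution)
    then interpret S: decaying_solution f L K r lam x0 x .
    interpret picard_trajectory f f' L K r C "h n" \<Lambda> "F n" J "g n" "B n" "W n" x0 "\<lambda>m. x (h n * real m)"
    proof
      show "h n * L * real (F n J) \<le> \<Lambda>"
        using F1 by (simp add: h_def \<Lambda>_def)
      show "0 \<le> g n m" "g n m \<le> K" for m
        using pos h by (auto simp: g_def)
      show "admissible_profiles (h n * L) K (F n) J (g n) (B n) (W n)"
        by (rule profiles[OF n(1)])
      show "error_rate (h n * L) \<Lambda> K * exp \<Lambda> \<le> K"
        using n(2) by (simp add: e_def)
      show "norm (x (h n * real m)) \<le> g n m * norm x0" for m
        using S.decay[of "h n * real m"] h by (simp add: g_def mult_ac)
      show "norm (x (h n * real (Suc m)) - x (h n * real m) - h n *\<^sub>R f (x (h n * real m)))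
          \<le> (h n * L)\<^sup>2 * K * norm x0" for m
        using S.euler_step[of "h n * real m" "h n"] h by (simp add: algebra_simps)
      show "norm (x (h n * real (m + i)) - x (h n * real m)) \<le> h n * L * real i * g n m * norm x0" for m i
        using S.drift[of "h n * real m" "h n * real (m + i)"] h by (simp add: g_def algebra_simps)
    qed (use pos C \<delta> h f_zero lipschitz F S.x0 S.x_0 in \<open>auto simp: \<Lambda>_def\<close>)
    have "\<eta> * exp \<Lambda> = e n" "\<theta> * exp \<Lambda> = d n"
      by (simp_all add: \<eta>_def \<theta>_def H_def e_def d_def)
    then have "gradient ?V x0 \<bullet> f x0 \<le> (A - 1 + e n * (4 * K + e n) +
        2 * (\<Lambda> * (2 * K * d n + e n * P + e n * d n))) * (norm x0)\<^sup>2"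
      using gradient_lyapunov_le[OF J, of P A] nonneg[OF n(1)] final[OF n(1)] by (simp add: H_def)
    also have "\<dots> \<le> (- ((1 - A) / 2)) * (norm x0)\<^sup>2"
      using n(3) by (intro mult_right_mono) (auto simp: field_simps)
    finally show ?thesis
      using lyapunov_bounds[OF F1] by simp
  qed
  show ?thesis
    unfolding sos_lyapunov_def
  proof (rule exI[of _ "h n"], rule exI[of _ "9 * K\<^sup>2 * h n * real (F n J)"],
      rule exI[of _ "(1 - A) / 2"], rule exI[of _ ?V], intro conjI ballI)
    show "sum_of_squares ?V" "poly_fun_degree ?V \<le> 2 * q ^ J"
      using f_degree h by (auto intro!: sum_of_squares_picard_lyapunov)
  qed (use * h F1 A pos in auto)
qed

end

section \<open>Explicit supersolutions\<close>

text \<open>A left Riemann sum of an increasing power lies below its integral. Each step is the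
  tangent inequality \<open>conv\<close> for the convex power.\<close>

lemma sum_power_le:
  fixes H :: real
  assumes "H \<ge> 0"
  shows "H * (\<Sum>l<m. (H * real l) ^ k) \<le> (H * real m) ^ Suc k / real (Suc k)"
proof (induction m)
  case (Suc m)
  have conv: "a ^ Suc k + real (Suc k) * H * a ^ k \<le> (a + H) ^ Suc k" if "a \<ge> 0" for a k
  proof (induction k)
    case (Suc k)
    have "a ^ Suc (Suc k) + real (Suc (Suc k)) * H * a ^ Suc k \<le>
        (a + H) * (a ^ Suc k + real (Suc k) * H * a ^ k)"
      using that assms by (simp add: algebra_simps)
    also have "\<dots> \<le> (a + H) * (a + H) ^ Suc k"
      using Suc that assms by (intro mult_left_mono) auto
    finally show ?case by simp
  qed simp
  have "H * (\<Sum>l<Suc m. (H * real l) ^ k) \<le> (H * real m) ^ Suc k / real (Suc k) + H * (H * real m) ^ k"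
    using Suc by (simp add: distrib_left)
  also have "\<dots> = ((H * real m) ^ Suc k + real (Suc k) * H * (H * real m) ^ k) / real (Suc k)"
    by (simp add: field_simps del: power_Suc)
  also have "\<dots> \<le> (H * real m + H) ^ Suc k / real (Suc k)"
    using assms by (intro divide_right_mono conv) auto
  also have "H * real m + H = H * real (Suc m)"
    by (simp add: algebra_simps)
  finally show ?case .
qed simp

text \<open>Comparison with the integral of the growing exponential from minus infinity, so the
  bound does not depend on the number of terms before \<open>m\<close>.\<close>

lemma sum_exp_decay_le:
  fixes H p c :: real
  assumes "p > 0"
  shows "H * (\<Sum>l<m. exp (- (p * H * (c - real l)))) \<le> exp (- (p * H * (c - real m))) / p"
proof -
  have eq: "exp (- (p * H * (c - real l))) = exp (- (p * H * c)) * exp (p * H * real l)" for l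
    by (simp add: algebra_simps flip: exp_add)
  have "p * H * (\<Sum>l<m. exp (p * H * real l)) \<le> exp (p * H * real m)"
    using sum_exp_le[of "p * H" m] by simp
  then have "exp (- (p * H * c)) * (p * H * (\<Sum>l<m. exp (p * H * real l))) \<le>
      exp (- (p * H * c)) * exp (p * H * real m)"
    by (intro mult_left_mono) auto
  then show ?thesis
    using assms unfolding eq sum_distrib_left[symmetric] by (simp add: field_simps)
qed

lemma sum_lessThan_plus:
  fixes p :: "nat \<Rightarrow> 'a::comm_monoid_add"
  shows "(\<Sum>l<a + b. p l) = (\<Sum>l<a. p l) + (\<Sum>i<b. p (a + i))"
  by (induction b) (auto simp: add.assoc)

context decaying_polynomial_field
begin

lemma horizon_pos: "ln (2 * K\<^sup>2) / (2 * lam) > 0"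
proof -
  have "1 \<le> K\<^sup>2" using pos by simp
  then have "2 * K\<^sup>2 > 1" by linarith
  then show ?thesis using pos by simp
qed

lemma decay_at_horizon: "(K * exp (- lam * (ln (2 * K\<^sup>2) / (2 * lam))))\<^sup>2 = 1 / 2"
proof -
  have K: "2 * K\<^sup>2 > 0" using pos by simp
  have "(exp (- lam * (ln (2 * K\<^sup>2) / (2 * lam))))\<^sup>2 = exp (- ln (2 * K\<^sup>2))"
    using pos by (simp flip: exp_double)
  also have "\<dots> = 1 / (2 * K\<^sup>2)"
    using K by (simp add: exp_minus inverse_eq_divide)
  finally show ?thesis
    using pos by (simp add: power_mult_distrib)
qed

section \<open>Short horizon: factorial supersolutions\<close>

text \<open>Every iterate after the zeroth is updated on the whole horizon, so in the time variable
  \<open>h * L * m\<close> the Volterra inequalities are repeated integration and powers over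
  factorials solve them. \<open>\<Lambda> \<le> 1\<close> keeps these below the cap
  \<open>K\<close>. In 3.4144, 2 comes from the defect and 1.4144 from the final norm.\<close>

lemma sos_lyapunov_short_horizon:
  assumes J: "J \<ge> 1"
    and \<Lambda>_def: "\<Lambda> = L * (ln (2 * K\<^sup>2) / (2 * lam))" and \<Lambda>: "\<Lambda> \<le> 1"
    and s_def: "s = \<Lambda> ^ Suc J / fact (Suc J)"
    and s: "3.4144 * (K * s) + K\<^sup>2 * s\<^sup>2 + K * s\<^sup>2 < 1 / 2"
  shows "sos_lyapunov (2 * q ^ J)"
proof -
  define \<delta> where "\<delta> = ln (2 * K\<^sup>2) / (2 * lam)"
  define F where "F n j = (if j = 0 then 0 else n + 1)" for n j :: nat
  define h where "h n = \<delta> / real (F n J)" for n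
  define g where "g n m = K * exp (- lam * (h n * real m))" for n m
  define B where "B n j m = K * ((h n * L * real m) ^ Suc j / fact (Suc j))" for n j m
  \<comment> \<open>The value 0 at \<open>j = 0\<close> is deliberate:
    \<open>defect_extension\<close> adds a jump of 1 at frontier 0, so the extended profile is the
    zeroth power over its factorial.\<close>
  define W where "W n j m = (if j = 0 then 0 else (h n * L * real m) ^ j / fact j)" for n j m
  have \<delta>: "\<delta> > 0" using horizon_pos by (simp add: \<delta>_def)
  have FJ: "F n J = n + 1" "F n (Suc j) = n + 1" for n j
    using J by (auto simp: F_def)
  have h: "h n > 0" for n using \<delta> by (simp add: h_def FJ add_pos_nonneg)
  have H: "h n * L > 0" for n using h pos by simp
  have HF: "h n * L * real (n + 1) = \<Lambda>" for n
    by (simp add: h_def FJ \<Lambda>_def \<delta>_def)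
  have Hm: "0 \<le> h n * L * real m" "h n * L * real m \<le> \<Lambda>" "h n * L * real m \<le> 1" if "m \<le> n + 1" for n m
  proof -
    have "h n * L * real m \<le> h n * L * real (n + 1)"
      using that H[of n] by (intro mult_left_mono) auto
    then show "h n * L * real m \<le> \<Lambda>" "h n * L * real m \<le> 1"
      using HF[of n] \<Lambda> by linarith+
    show "0 \<le> h n * L * real m" using H[of n] by simp
  qed
  have g_le: "g n m \<le> K" "g n 0 = K" for n m
    using pos h[of n] by (auto simp: g_def)
  have frac: "0 \<le> (h n * L * real m) ^ j / fact j" "(h n * L * real m) ^ j / fact j \<le> 1" if "m \<le> n + 1" for n m j
  proof -
    show "0 \<le> (h n * L * real m) ^ j / fact j"
      using Hm[OF that] by simp
    have "(h n * L * real m) ^ j \<le> 1"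
      using Hm[OF that] by (intro power_le_one) auto
    also have "(1::real) \<le> fact j" by simp
    finally show "(h n * L * real m) ^ j / fact j \<le> 1" by simp
  qed
  have B_le: "0 \<le> B n j m" "B n j m \<le> K" if "m \<le> n + 1" for n j m
  proof -
    show "0 \<le> B n j m"
      unfolding B_def using pos by (intro mult_nonneg_nonneg frac that) auto
    have "B n j m \<le> K * 1"
      unfolding B_def using pos by (intro mult_left_mono frac that) auto
    then show "B n j m \<le> K" by simp
  qed
  have B_ext: "error_extension (h n * L) (F n) (g n) (B n) j l = B n j l" if "l \<le> n + 1" for n j l
    using that g_le by (auto simp: error_extension_def B_def F_def)
  have W_ext: "defect_extension (F n) (g n) (B n) (W n) j l = (h n * L * real l) ^ j / fact j"
    if "l < n + 1" for n j l
    using that by (auto simp: defect_extension_def W_def F_def)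
  have step: "h n * L * (\<Sum>l<m. (h n * L * real l) ^ j / fact j) \<le> (h n * L * real m) ^ Suc j / fact (Suc j)" for n m j
    using divide_right_mono[OF sum_power_le[of "h n * L" j m], of "fact j"] H[of n]
    by (simp add: sum_divide_distrib[symmetric] mult.commute del: power_Suc of_nat_Suc)
  \<comment> \<open>The first three terms bound the squared norm at the horizon, with 0.7072 as an
    upper bound for the square root of 1/2; the bracket bounds the defect contribution.\<close>
  let ?A = "1 / 2 + 1.4144 * (K * s) + (K * s)\<^sup>2 + (2 * (K * s) + K * s\<^sup>2)"
  have s0: "s \<ge> 0"
    using Hm[of 0 0] Hm[of 1 0] by (simp add: s_def)
  show ?thesis
  proof (rule sos_lyapunov_from_profiles[OF \<delta> J, where F = F and h = h and g = g and B = B and W = W and P = 1 and A = ?A])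
    show "?A < 1"
      using s by (simp add: power_mult_distrib)
    show "F n 0 = 0" "mono (F n)" "n \<le> F n J" for n
      using J by (auto simp: F_def mono_def)
    fix n :: nat
    show "admissible_profiles (h n * L) K (F n) J (g n) (B n) (W n)"
      unfolding admissible_profiles_def
    proof (intro conjI allI impI)
      show "0 \<le> B n 0 0" "0 \<le> W n 0 0" by (auto simp: B_def W_def)
      show "B n j m \<le> K" if "m \<le> F n j" for j m
        using that by (intro B_le) (auto simp: F_def split: if_splits)
      fix j m assume m: "m \<le> F n (Suc j)"
      then have m': "m \<le> n + 1" by (simp add: FJ)
      show "error_extension (h n * L) (F n) (g n) (B n) j m \<le> K"
        unfolding B_ext[OF m'] by (rule B_le[OF m'])
      have "h n * L * (\<Sum>l<m. error_extension (h n * L) (F n) (g n) (B n) j l) =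
          K * (h n * L * (\<Sum>l<m. (h n * L * real l) ^ Suc j / fact (Suc j)))"
        using m' B_ext by (simp add: B_def sum_distrib_left mult_ac del: power_Suc fact_Suc)
      also have "\<dots> \<le> B n (Suc j) m"
        using step[of n "Suc j" m] pos unfolding B_def by (intro mult_left_mono) auto
      finally show "h n * L * (\<Sum>l<m. error_extension (h n * L) (F n) (g n) (B n) j l) \<le> B n (Suc j) m" .
      have "(\<Sum>l<m. defect_extension (F n) (g n) (B n) (W n) j l) = (\<Sum>l<m. (h n * L * real l) ^ j / fact j)"
        using m' W_ext by (intro sum.cong) auto
      then show "h n * L * (\<Sum>l<m. defect_extension (F n) (g n) (B n) (W n) j l) \<le> W n (Suc j) m"
        using step[of n j m] by (simp add: W_def del: power_Suc fact_Suc)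
    qed
    show "0 \<le> B n J m \<and> 0 \<le> W n J m \<and> W n J m \<le> 1" if "m \<le> F n J" for m
      using that B_le[of m n J] frac[of m n J] J by (auto simp: FJ W_def)
    have gM: "(g n (F n J))\<^sup>2 = 1 / 2" "g n (F n J) \<ge> 0"
      using decay_at_horizon pos by (auto simp: g_def h_def FJ \<delta>_def)
    have gM': "g n (F n J) \<le> 0.7072"
    proof (rule power2_le_imp_le)
      show "(g n (F n J))\<^sup>2 \<le> 0.7072\<^sup>2"
        unfolding gM(1) by (simp add: power2_eq_square)
    qed simp
    have BM: "B n J (F n J) = K * s"
      unfolding B_def FJ HF s_def ..
    have "(g n (F n J) + B n J (F n J))\<^sup>2 = 1 / 2 + 2 * g n (F n J) * (K * s) + (K * s)\<^sup>2"
      unfolding BM power2_sum gM by simp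
    also have "\<dots> \<le> 1 / 2 + 1.4144 * (K * s) + (K * s)\<^sup>2"
      using gM' pos s0 by (intro add_mono mult_right_mono) auto
    finally have 1: "(g n (F n J) + B n J (F n J))\<^sup>2 \<le> 1 / 2 + 1.4144 * (K * s) + (K * s)\<^sup>2" .
    let ?x = "\<lambda>m. h n * L * real m"
    have "(\<Sum>m<F n J. (g n m + B n J m) * W n J m) \<le>
        (\<Sum>m<F n J. K * (?x m ^ J / fact J) + K / (fact J * fact (Suc J)) * ?x m ^ (2 * J + 1))"
    proof (rule sum_mono)
      fix m assume "m \<in> {..<F n J}"
      then have m: "m \<le> n + 1" by (simp add: FJ)
      have "(g n m + B n J m) * W n J m \<le> (K + B n J m) * W n J m"
        using frac(1)[OF m, of J] g_le(1)[of n m] by (intro mult_right_mono) (auto simp: W_def)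
      also have "\<dots> = K * (?x m ^ J / fact J) + K / (fact J * fact (Suc J)) * (?x m ^ Suc J * ?x m ^ J)"
      proof -
        have "(K + K * (a / c)) * (b / d) = K * (b / d) + K / (d * c) * (a * b)" for a b c d :: real
          by (simp add: algebra_simps add_divide_distrib)
        moreover have "W n J m = ?x m ^ J / fact J"
          using J by (simp add: W_def)
        ultimately show ?thesis by (simp only: B_def)
      qed
      also have "\<dots> = K * (?x m ^ J / fact J) + K / (fact J * fact (Suc J)) * ?x m ^ (2 * J + 1)"
        by (simp only: power_add[symmetric]) (simp add: mult_2)
      finally show "(g n m + B n J m) * W n J m \<le>
          K * (?x m ^ J / fact J) + K / (fact J * fact (Suc J)) * ?x m ^ (2 * J + 1)" .
    qed
    then have "h n * L * (\<Sum>m<F n J. (g n m + B n J m) * W n J m) \<le>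
        h n * L * (\<Sum>m<F n J. K * (?x m ^ J / fact J) + K / (fact J * fact (Suc J)) * ?x m ^ (2 * J + 1))"
      using H[of n] by (intro mult_left_mono) auto
    also have "\<dots> = K * (h n * L * (\<Sum>m<F n J. ?x m ^ J / fact J)) +
        K / (fact J * fact (Suc J)) * (h n * L * (\<Sum>m<F n J. ?x m ^ (2 * J + 1)))"
      unfolding sum.distrib sum_distrib_left[symmetric] distrib_left by (simp only: mult_ac)
    also have "\<dots> \<le> K * s + K / (fact J * fact (Suc J)) * (\<Lambda> ^ Suc (2 * J + 1) / real (Suc (2 * J + 1)))"
      using step[of n J "F n J"] sum_power_le[of "h n * L" "2 * J + 1" "F n J"] H[of n] pos
      unfolding FJ HF s_def by (intro add_mono mult_left_mono) auto
    also have "\<dots> = K * s + K * s\<^sup>2 / 2"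
    proof -
      have "\<Lambda> ^ Suc (2 * J + 1) = (\<Lambda> ^ Suc J)\<^sup>2"
        by (simp add: power2_eq_square power_add mult_2)
      moreover have "fact (Suc J) * (fact J * real (Suc (2 * J + 1))) = 2 * (fact (Suc J))\<^sup>2"
        by (simp add: power2_eq_square algebra_simps)
      then have "K / (fact J * fact (Suc J)) * (X / real (Suc (2 * J + 1))) = K * (X / (fact (Suc J))\<^sup>2) / 2" for X
        by (simp only: times_divide_times_eq mult_ac times_divide_eq_right times_divide_eq_left divide_divide_eq_left)
      ultimately show ?thesis
        by (simp only: s_def power_divide)
    qed
    finally have "2 * (h n * L * (\<Sum>m<F n J. (g n m + B n J m) * W n J m)) \<le> 2 * (K * s) + K * s\<^sup>2"
      by linarith
    with 1 show "(g n (F n J) + B n J (F n J))\<^sup>2 +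
        2 * (h n * L * (\<Sum>m<F n J. (g n m + B n J m) * W n J m)) \<le> ?A"
      by linarith
  qed (auto simp: h_def g_def)
qed

section \<open>Long horizon: exponential supersolutions behind a moving frontier\<close>

text \<open>The frontier advances by at most 1/5, in units of \<open>1 / L\<close>, per iteration.
  \<open>W\<close> equals \<open>g\<close> at the frontier and decays at rate 4 behind it. Summation
  gains a factor 1/4, whereas moving the frontier costs at most \<open>exp (- 1)\<close>: 4/5 in the
  exponent from the weight and, by \<open>lam \<le> L\<close>, 1/5 from \<open>g\<close>. The
  surplus pays for the stretch beyond the old frontier.\<close>

lemma sos_lyapunov_long_horizon:
  assumes J: "J \<ge> 1" and lam_le: "lam \<le> L"
    and horizon: "5 * (L * (ln (2 * K\<^sup>2) / (2 * lam))) \<le> real J"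
  shows "sos_lyapunov (2 * q ^ J)"
proof -
  define \<delta> where "\<delta> = ln (2 * K\<^sup>2) / (2 * lam)"
  define F where "F n j = j * (n + 1)" for n j :: nat
  define h where "h n = \<delta> / real (F n J)" for n
  define g where "g n m = K * exp (- lam * (h n * real m))" for n m
  define W where "W n j m = g n (F n j) * exp (- (4 * (h n * L) * (real (F n j) - real m)))" for n j m
  define B where "B n j m = W n j m / 12" for n j m
  have \<delta>: "\<delta> > 0" using horizon_pos by (simp add: \<delta>_def)
  have FJ: "F n J > 0" for n
    using J by (simp add: F_def)
  have h: "h n > 0" for n using \<delta> FJ[of n] by (simp add: h_def)
  have H: "h n * L > 0" for n using h pos by simp
  have mesh: "h n * L * real (n + 1) \<le> 1 / 5" for n
  proof -
    define k where "k = real (n + 1)"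
    have "k > 0" "h n = \<delta> / (real J * k)"
      by (simp_all add: k_def h_def F_def distrib_left)
    then have "h n * L * k = L * \<delta> / real J"
      by simp
    also have "\<dots> \<le> 1 / 5"
      using horizon[folded \<delta>_def] J by (simp add: divide_simps)
    finally show ?thesis by (simp only: k_def)
  qed
  have F_Suc: "F n (Suc j) = F n j + (n + 1)" for n j
    by (simp add: F_def)
  have g_pos: "0 < g n m" and g_le: "g n m \<le> K" and g_0: "g n 0 = K" for n m
    using pos h[of n] by (auto simp: g_def)
  have g_decay: "g n l \<le> g n (l + i) * exp (h n * L * real i)" for n l i
  proof -
    have "g n l = g n (l + i) * exp (lam * (h n * real i))"
      by (simp add: g_def algebra_simps flip: exp_add)
    also have "\<dots> \<le> g n (l + i) * exp (h n * L * real i)"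
      using lam_le h[of n] g_pos[of n "l + i"] pos
      by (intro mult_left_mono) (auto simp: mult_ac intro!: mult_mono)
    finally show ?thesis .
  qed
  have g_Suc: "g n (F n j) * exp (- (h n * L * real (n + 1))) \<le> g n (F n (Suc j))" for n j
  proof -
    let ?e = "h n * L * real (n + 1)"
    have "g n (F n j) * exp (- ?e) \<le> (g n (F n (Suc j)) * exp ?e) * exp (- ?e)"
      unfolding F_Suc by (intro mult_right_mono g_decay) simp
    then show ?thesis by (simp only: mult.assoc exp_add[symmetric]) simp
  qed
  have g_Suc': "g n (F n j) \<le> 1.25 * g n (F n (Suc j))" for n j
  proof -
    have "g n (F n j) * (4 / 5) \<le> g n (F n j) * exp (- (h n * L * real (n + 1)))"
      using mesh[of n] exp_ge_add_one_self[of "- (h n * L * real (n + 1))"] g_pos[of n "F n j"]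
      by (intro mult_left_mono) linarith+
    also have "\<dots> \<le> g n (F n (Suc j))" by (rule g_Suc)
    finally show ?thesis by simp
  qed
  have W_pos: "0 < W n j m" for n j m
    using g_pos by (simp add: W_def)
  have W_le: "W n j m \<le> g n (F n j)" if "m \<le> F n j" for n j m
    using g_pos[of n "F n j"] H[of n] that by (simp add: W_def)
  have W_F: "W n j (F n j) = g n (F n j)" for n j
    by (simp add: W_def)
  have W_sum: "h n * L * (\<Sum>l<m. W n j l) \<le> W n j m / 4" for n j m
    using mult_left_mono[OF sum_exp_decay_le[of 4 "h n * L" "real (F n j)" m], of "g n (F n j)"] g_pos[of n "F n j"]
    by (simp add: W_def sum_distrib_left[symmetric] mult_ac)
  \<comment> \<open>A rational lower bound, since 0.3676 is less than 1/2.72.\<close>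
  have e1: "exp (- 1) \<ge> (0.3676 :: real)"
    using e_less_272 by (simp add: exp_minus field_simps)
  have W_grow: "W n (Suc j) m \<ge> 0.3676 * (exp (4 * (h n * L) * (real m - real (F n j))) * g n (F n j))" for n j m
  proof -
    let ?E = "exp (4 * (h n * L) * (real m - real (F n j)))"
    have "0.3676 * (?E * g n (F n j)) \<le> exp (- (5 * (h n * L * real (n + 1)))) * (?E * g n (F n j))"
      using e1 mesh[of n] g_pos[of n "F n j"]
      by (intro mult_right_mono order_trans[OF e1]) auto
    also have "\<dots> = (g n (F n j) * exp (- (h n * L * real (n + 1)))) *
        exp (- (4 * (h n * L) * (real (F n (Suc j)) - real m)))"
      by (simp add: F_Suc algebra_simps flip: exp_add)
    also have "\<dots> \<le> W n (Suc j) m"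
      unfolding W_def by (intro mult_right_mono g_Suc) auto
    finally show ?thesis .
  qed
  \<comment> \<open>One argument serves both Volterra inequalities for a profile
    \<open>a * W\<close>: beyond the frontier the summand is at most \<open>g\<close> there times an
    affine function of the elapsed time. \<open>bc\<close> is what remains once
    \<open>exp (4 * \<sigma>)\<close> is replaced by its quadratic Taylor polynomial.\<close>
  have ext_sum: "h n * L * (\<Sum>l<m. p l) \<le> a * W n (Suc j) m"
    if m: "m \<le> F n (Suc j)" and a: "a > 0"
      and p: "\<And>l. l < F n j \<Longrightarrow> p l = a * W n j l"
      and p': "\<And>i. i < n + 1 \<Longrightarrow> p (F n j + i) \<le> g n (F n j) * (b + c * (h n * L * real i))"
      and bc: "\<And>\<sigma>. 0 \<le> \<sigma> \<Longrightarrow> \<sigma> \<le> 1 / 5 \<Longrightarrow> a / 4 + b * \<sigma> + c * \<sigma>\<^sup>2 / 2 \<le> a * (0.3676 * (1 + 4 * \<sigma> + 8 * \<sigma>\<^sup>2))"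
      and c: "c \<ge> 0"
    for n j m a b c and p :: "nat \<Rightarrow> real"
  proof (cases "m \<le> F n j")
    case True
    have "h n * L * (\<Sum>l<m. p l) = a * (h n * L * (\<Sum>l<m. W n j l))"
      using True p by (simp add: sum_distrib_left mult_ac)
    also have "\<dots> \<le> a * (W n j m / 4)"
      using a by (intro mult_left_mono W_sum) auto
    also have "\<dots> \<le> a * (0.3676 * W n j m)"
      using a W_pos[of n j m] by (intro mult_left_mono) auto
    also have "\<dots> \<le> a * W n (Suc j) m"
      using W_grow[where m = m and n = n and j = j] a by (intro mult_left_mono) (auto simp: W_def algebra_simps)
    finally show ?thesis .
  next
    case False
    define i where "i = m - F n j"
    have m_eq: "m = F n j + i" and i: "i \<le> n + 1"
      using False m by (auto simp: i_def F_Suc)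
    define \<sigma> where "\<sigma> = h n * L * real i"
    have \<sigma>: "0 \<le> \<sigma>" "\<sigma> \<le> 1 / 5"
    proof -
      show "0 \<le> \<sigma>" using H[of n] by (simp add: \<sigma>_def)
      have "\<sigma> \<le> h n * L * real (n + 1)"
        unfolding \<sigma>_def using H[of n] i by (intro mult_left_mono) auto
      then show "\<sigma> \<le> 1 / 5" using mesh[of n] by linarith
    qed
    let ?G = "g n (F n j)"
    have "h n * L * (\<Sum>l<m. p l) = h n * L * (\<Sum>l<F n j. p l) + h n * L * (\<Sum>l<i. p (F n j + l))"
      unfolding m_eq sum_lessThan_plus by (rule distrib_left)
    also have "\<dots> \<le> a * (?G / 4) + ?G * (b * \<sigma> + c * \<sigma>\<^sup>2 / 2)"
    proof (rule add_mono)
      have "h n * L * (\<Sum>l<F n j. p l) = a * (h n * L * (\<Sum>l<F n j. W n j l))"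
        using p by (simp add: sum_distrib_left mult_ac)
      also have "\<dots> \<le> a * (?G / 4)"
        using a W_sum[of n j "F n j"] by (intro mult_left_mono) (auto simp: W_F)
      finally show "h n * L * (\<Sum>l<F n j. p l) \<le> a * (?G / 4)" .
      have "h n * L * (\<Sum>l<i. p (F n j + l)) \<le> h n * L * (\<Sum>l<i. ?G * (b + c * (h n * L * real l)))"
        using H[of n] i p' by (intro mult_left_mono sum_mono) auto
      also have "\<dots> = ?G * (b * \<sigma> + c * (h n * L * (\<Sum>l<i. (h n * L * real l) ^ 1)))"
        by (simp add: \<sigma>_def sum.distrib distrib_left sum_distrib_left mult_ac)
      also have "\<dots> \<le> ?G * (b * \<sigma> + c * (\<sigma>\<^sup>2 / 2))"
        using sum_power_le[of "h n * L" 1 i] H[of n] g_pos[of n "F n j"] c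
        by (intro mult_left_mono add_left_mono) (auto simp: \<sigma>_def power2_eq_square)
      finally show "h n * L * (\<Sum>l<i. p (F n j + l)) \<le> ?G * (b * \<sigma> + c * \<sigma>\<^sup>2 / 2)" by simp
    qed
    also have "\<dots> = ?G * (a / 4 + b * \<sigma> + c * \<sigma>\<^sup>2 / 2)"
      by (simp add: algebra_simps)
    also have "\<dots> \<le> ?G * (a * (0.3676 * (1 + 4 * \<sigma> + 8 * \<sigma>\<^sup>2)))"
      using g_pos[of n "F n j"] by (intro mult_left_mono bc \<sigma>) auto
    also have "\<dots> \<le> ?G * (a * (0.3676 * exp (4 * \<sigma>)))"
      using exp_lower_Taylor_quadratic[of "4 * \<sigma>"] \<sigma> g_pos[of n "F n j"] a
      by (intro mult_left_mono) (auto simp: power_mult_distrib)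
    also have "\<dots> = a * (0.3676 * (exp (4 * (h n * L) * (real m - real (F n j))) * ?G))"
      by (simp add: \<sigma>_def m_eq mult_ac)
    also have "\<dots> \<le> a * W n (Suc j) m"
      using a by (intro mult_left_mono W_grow) auto
    finally show ?thesis .
  qed
  show ?thesis
  \<comment> \<open>0.94 is a rounded upper bound for 169/288 + 2 (1/6 + 1/192), obtained at the
    end.\<close>
  proof (rule sos_lyapunov_from_profiles[OF \<delta> J, where F = F and h = h and g = g and B = B and W = W and P = K and A = "0.94"])
    show "F n 0 = 0" "mono (F n)" "n \<le> F n J" for n
    proof -
      have "1 * n \<le> J * (n + 1)"
        using J by (intro mult_mono) auto
      then show "n \<le> F n J" by (simp add: F_def)
    qed (auto simp: F_def mono_def intro: add_mono mult_le_mono1)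
    fix n :: nat
    have W_K: "W n j m \<le> K" if "m \<le> F n j" for j m
      using W_le[OF that] g_le by (rule order_trans)
    show "admissible_profiles (h n * L) K (F n) J (g n) (B n) (W n)"
      unfolding admissible_profiles_def
    proof (intro conjI allI impI)
      show "0 \<le> B n 0 0" "0 \<le> W n 0 0"
        using W_pos[of n 0 0] by (auto simp: B_def)
      show B_K: "B n j m \<le> K" if "m \<le> F n j" for j m
        using W_K[OF that] pos W_pos[of n j m] by (simp add: B_def)
      fix j m assume m: "m \<le> F n (Suc j)"
      show "error_extension (h n * L) (F n) (g n) (B n) j m \<le> K"
      proof (cases "m \<le> F n j")
        case False
        have "h n * L * real (m - F n j) \<le> h n * L * real (n + 1)"
          using m H[of n] by (intro mult_left_mono) (auto simp: F_Suc)
        then have "h n * L * real (m - F n j) \<le> 1 / 5" using mesh[of n] by linarith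
        then have "h n * L * real (m - F n j) * g n (F n j) \<le> 1 / 5 * g n (F n j)"
          using g_pos[of n "F n j"] by (intro mult_right_mono) auto
        moreover have "error_extension (h n * L) (F n) (g n) (B n) j m =
            g n (F n j) / 12 + h n * L * real (m - F n j) * g n (F n j)"
          using False by (simp add: error_extension_def B_def W_F)
        ultimately show ?thesis
          using g_pos[of n "F n j"] g_le[of n "F n j"] by linarith
      qed (simp add: error_extension_def B_K)
      have "h n * L * (\<Sum>l<m. error_extension (h n * L) (F n) (g n) (B n) j l) \<le> 1 / 12 * W n (Suc j) m"
      \<comment> \<open>Beyond the frontier the error starts at 1/12 of \<open>g\<close> and the
        drift adds slope 1.\<close>
      proof (rule ext_sum[OF m, where b = "1 / 12" and c = 1])
        fix \<sigma> :: real assume \<sigma>: "0 \<le> \<sigma>" "\<sigma> \<le> 1 / 5"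
        then have "\<sigma> * \<sigma> \<le> \<sigma> * (1 / 5)" by (intro mult_left_mono) auto
        then show "1 / 12 / 4 + 1 / 12 * \<sigma> + 1 * \<sigma>\<^sup>2 / 2 \<le> 1 / 12 * (0.3676 * (1 + 4 * \<sigma> + 8 * \<sigma>\<^sup>2))"
          using \<sigma> by (simp add: power2_eq_square)
      qed (auto simp: error_extension_def B_def W_F algebra_simps)
      then show "h n * L * (\<Sum>l<m. error_extension (h n * L) (F n) (g n) (B n) j l) \<le> B n (Suc j) m"
        by (simp add: B_def)
      \<comment> \<open>1.3542 rounds up 1.25 times 13/12: the loss of \<open>g\<close> over one
        frontier step, and the share \<open>g + B\<close> at the previous frontier. For
        \<open>j = 0\<close> the claim follows from \<open>K \<ge> 1\<close>.\<close>
      have y: "(case j of 0 \<Rightarrow> 1 | Suc i \<Rightarrow> g n (F n i) + B n i (F n i)) \<le> 1.3542 * g n (F n j)"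
      proof (cases j)
        case 0
        then show ?thesis using pos by (simp add: F_def g_0)
      next
        case (Suc i)
        then show ?thesis using g_Suc'[of n i] g_pos[of n "F n j"] by (simp add: B_def W_F)
      qed
      have "h n * L * (\<Sum>l<m. defect_extension (F n) (g n) (B n) (W n) j l) \<le> 1 * W n (Suc j) m"
      \<comment> \<open>The jump 1.3542 plus the amplitude 1 of \<open>W\<close> at the
        frontier.\<close>
      proof (rule ext_sum[OF m, where b = "2.3542" and c = 0])
        fix \<sigma> :: real assume \<sigma>: "0 \<le> \<sigma>" "\<sigma> \<le> 1 / 5"
        \<comment> \<open>The difference of the two sides is a quadratic with its minimum near
          0.15.\<close>
        have "0 \<le> (\<sigma> - 0.15)\<^sup>2" by simp
        then have "0.3 * \<sigma> \<le> \<sigma> * \<sigma> + 0.0225" by (simp add: power2_eq_square algebra_simps)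
        then show "1 / 4 + 2.3542 * \<sigma> + 0 * \<sigma>\<^sup>2 / 2 \<le> 1 * (0.3676 * (1 + 4 * \<sigma> + 8 * \<sigma>\<^sup>2))"
          using \<sigma> by (simp add: power2_eq_square)
      qed (use y in \<open>auto simp: defect_extension_def W_F\<close>)
      then show "h n * L * (\<Sum>l<m. defect_extension (F n) (g n) (B n) (W n) j l) \<le> W n (Suc j) m"
        by simp
    qed
    show "0 \<le> B n J m \<and> 0 \<le> W n J m \<and> W n J m \<le> K" if "m \<le> F n J" for m
      using W_pos[of n J m] W_K[OF that] by (simp add: B_def)
    let ?G = "g n (F n J)" and ?y = "\<lambda>m. real (F n J) - real m"
    have G: "?G\<^sup>2 = 1 / 2"
      using decay_at_horizon FJ[of n] by (simp add: g_def h_def \<delta>_def)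
    \<comment> \<open>Backwards from the horizon \<open>g\<close> grows at most at rate 1 while
      \<open>W\<close> and \<open>B\<close> decay at rate 4, which leaves the rates 3 and 8.\<close>
    have "(g n m + B n J m) * W n J m \<le>
        ?G\<^sup>2 * exp (- (3 * (h n * L) * ?y m)) + ?G\<^sup>2 / 12 * exp (- (8 * (h n * L) * ?y m))" if "m < F n J" for m
    proof -
      have "g n m \<le> ?G * exp (h n * L * ?y m)"
        using g_decay[of n m "F n J - m"] that by (simp add: of_nat_diff)
      then have "g n m * W n J m \<le> ?G * exp (h n * L * ?y m) * W n J m"
        using W_pos[of n J m] by (intro mult_right_mono) auto
      also have "\<dots> = ?G\<^sup>2 * exp (- (3 * (h n * L) * ?y m))"
        by (simp add: W_def power2_eq_square algebra_simps flip: exp_add)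
      finally have 1: "g n m * W n J m \<le> ?G\<^sup>2 * exp (- (3 * (h n * L) * ?y m))" .
      have "B n J m * W n J m = ?G\<^sup>2 / 12 * exp (- (8 * (h n * L) * ?y m))"
        by (simp add: B_def W_def power2_eq_square algebra_simps flip: exp_add)
      with 1 show ?thesis by (simp add: distrib_right)
    qed
    then have "h n * L * (\<Sum>m<F n J. (g n m + B n J m) * W n J m) \<le>
        h n * L * (\<Sum>m<F n J. ?G\<^sup>2 * exp (- (3 * (h n * L) * ?y m)) + ?G\<^sup>2 / 12 * exp (- (8 * (h n * L) * ?y m)))"
      using H[of n] by (intro mult_left_mono sum_mono) auto
    also have "\<dots> = ?G\<^sup>2 * (h n * L * (\<Sum>m<F n J. exp (- (3 * (h n * L) * ?y m)))) +
        ?G\<^sup>2 / 12 * (h n * L * (\<Sum>m<F n J. exp (- (8 * (h n * L) * ?y m))))"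
      unfolding sum.distrib sum_distrib_left[symmetric] distrib_left by (simp only: mult_ac)
    also have "\<dots> \<le> ?G\<^sup>2 * (1 / 3) + ?G\<^sup>2 / 12 * (1 / 8)"
      using sum_exp_decay_le[of 3 "h n * L" "real (F n J)" "F n J"]
        sum_exp_decay_le[of 8 "h n * L" "real (F n J)" "F n J"]
      by (intro add_mono mult_left_mono) auto
    finally have 1: "h n * L * (\<Sum>m<F n J. (g n m + B n J m) * W n J m) \<le> 1 / 6 + 1 / 192"
      by (simp add: G)
    have "(?G + B n J (F n J))\<^sup>2 = (13 / 12)\<^sup>2 * ?G\<^sup>2"
      unfolding B_def W_F power_mult_distrib[symmetric] by simp
    also have "\<dots> = 169 / 288"
      unfolding G by (simp add: power2_eq_square)
    finally have "(?G + B n J (F n J))\<^sup>2 = 169 / 288" .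
    with 1 show "(?G + B n J (F n J))\<^sup>2 + 2 * (h n * L * (\<Sum>m<F n J. (g n m + B n J m) * W n J m)) \<le> 0.94"
      by simp
  qed (auto simp: h_def g_def)
qed

end

section \<open>The converse theorem\<close>

lemma total_degree_le_0_const:
  assumes "total_degree_le 0 p"
  shows "p x = p y"
proof -
  have "{a :: 'a \<Rightarrow> nat. sum a UNIV \<le> 0} = {\<lambda>_. 0}"
    by auto
  then show ?thesis
    using assms unfolding total_degree_le_def by (auto simp: monomial_fun_def)
qed

lemma total_degree_le_vector_field_degree:
  assumes "polynomial_function f"
  shows "total_degree_le (vector_field_degree f) (\<lambda>x. f x $ i)"
proof -
  have "poly_fun_degree (\<lambda>x. f x $ i) \<le> vector_field_degree f"
    unfolding vector_field_degree_def by (intro Max_ge) auto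
  then show ?thesis
    using poly_fun_degree_le_iff[OF polynomial_function_nth[OF assms]] by blast
qed

context decaying_polynomial_field
begin

lemma sos_lyapunov_mono: "sos_lyapunov d \<Longrightarrow> d \<le> e \<Longrightarrow> sos_lyapunov e"
  unfolding sos_lyapunov_def by (meson le_trans)

end

text \<open>For nonnegative \<open>y\<close> the left side increases, and at 0.27 it is already
  about 0.508.\<close>

lemma cubic_bound:
  fixes y :: real
  assumes "y\<^sup>2 + y * (1 + y) * (1 + y) < 1 / 2"
  shows "y < 0.27"
proof (rule ccontr)
  assume "\<not> y < 0.27"
  then have y: "0.27 \<le> y" by simp
  have "0.27 * 0.27 \<le> y * y" "0.27 * 1.27 * 1.27 \<le> y * (1 + y) * (1 + y)"
    using y by (intro mult_mono; simp)+
  with assms show False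
    by (simp add: power2_eq_square)
qed

theorem theorem1:
  fixes f :: "real ^ 'n \<Rightarrow> real ^ 'n" and M :: "(real ^ 'n) set"
    and q :: nat and r lam K L T :: real and N k :: int and c :: "int \<Rightarrow> real"
  assumes f_poly: "polynomial_function f"
    and f_degree: "vector_field_degree f = q"
    and f_zero: "f 0 = 0"
    and r_pos: "r > 0"
    and M_nonempty: "M \<noteq> {}"
    and M_subset: "M \<subseteq> cball 0 r"
    and lam_pos: "lam > 0"
    and K_ge: "K \<ge> 1"
    and decay: "\<forall>x0\<in>M. \<exists>x. x 0 = x0 \<and> (\<forall>t\<ge>0. (x has_vector_derivative f (x t)) (at t within {0..})) \<and>
                  (\<forall>t\<ge>0. norm (x t) \<le> K * norm x0 * exp (- lam * t))"
    and L_pos: "L > 0"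
    and lipschitz: "L-lipschitz_on (cball 0 (4 * K * r)) f"
    and T_pos: "T > 0"
    and T_less: "T < 1 / (2 * L)"
    and NT: "of_int N * T > ln (2 * K\<^sup>2) / (2 * lam)"
    and c_def: "\<And>j. c j =
      (\<Sum>i<nat N. (exp (T * L) + K * (T * L) powi j) ^ i * K\<^sup>2 * (T * L) powi j)"
    and ck1: "c k < K"
    and ck2: "(c k)\<^sup>2 + ln (2 * K\<^sup>2) / (2 * lam) * K * ((T * L) powi k / T)
                * (1 + c k) * (K + c k) < 1 / 2"
    and ck3: "(c k)\<^sup>2 < lam / (K * L * ln (2 * K\<^sup>2)) * (1 - (2 * K\<^sup>2) powr (- L / lam))"
  shows "\<exists>\<alpha> \<beta> \<gamma> :: real. \<exists>V :: real ^ 'n \<Rightarrow> real.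
    \<alpha> > 0 \<and> \<beta> > 0 \<and> \<gamma> > 0 \<and>
    sum_of_squares V \<and> poly_fun_degree V \<le> 2 * q ^ nat (N * k - 1) \<and>
    (\<forall>x\<in>M. \<alpha> * (norm x)\<^sup>2 \<le> V x \<and> V x \<le> \<beta> * (norm x)\<^sup>2 \<and>
           gradient V x \<bullet> f x \<le> - \<gamma> * (norm x)\<^sup>2)"
proof -
  define \<delta> where "\<delta> = ln (2 * K\<^sup>2) / (2 * lam)"
  define \<Lambda> where "\<Lambda> = L * \<delta>"
  define \<tau> where "\<tau> = T * L"
  define \<epsilon> where "\<epsilon> = \<tau> powi k"
  \<comment> \<open>This equals \<open>\<delta> * \<epsilon> / T\<close>, so \<open>K * y\<close> is
    the coefficient of the product in \<open>ck2\<close>.\<close>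
  define y where "y = \<Lambda> * (\<epsilon> / \<tau>)"
  have K2: "1 \<le> K\<^sup>2" using K_ge by simp
  then have "ln (2 * K\<^sup>2) > 0" by (intro ln_gt_zero) linarith
  then have \<delta>: "\<delta> > 0" using lam_pos by (simp add: \<delta>_def)
  have \<Lambda>: "\<Lambda> > 0" using \<delta> L_pos by (simp add: \<Lambda>_def)
  have \<tau>: "0 < \<tau>" "\<tau> < 1 / 2"
    using T_pos L_pos T_less by (auto simp: \<tau>_def field_simps)
  have "0 < of_int N * T" using NT \<delta> by (simp add: \<delta>_def)
  then have N: "N \<ge> 1" using T_pos by (simp add: zero_less_mult_iff)
  have \<Lambda>_less: "\<Lambda> < of_int N * \<tau>"
    using mult_strict_left_mono[OF NT L_pos] by (simp add: \<Lambda>_def \<delta>_def \<tau>_def mult_ac)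
  have \<epsilon>: "\<epsilon> > 0" using \<tau> by (simp add: \<epsilon>_def)
  have y: "y > 0" using \<Lambda> \<tau> \<epsilon> by (simp add: y_def)
  \<comment> \<open>The powers in the sum are at least 1, so \<open>c k\<close> is at least
    \<open>N\<close> times \<open>K\<^sup>2 * \<epsilon>\<close>; then
    \<open>\<Lambda> < N * \<tau>\<close> turns this into a bound by \<open>y\<close>.\<close>
  have c_ge: "K\<^sup>2 * y \<le> c k"
  proof -
    have "y \<le> of_int N * \<tau> * (\<epsilon> / \<tau>)"
      unfolding y_def using \<Lambda>_less \<epsilon> \<tau> by (intro mult_right_mono) auto
    also have "\<dots> = of_int N * \<epsilon>"
      using \<tau> by simp
    finally have "K\<^sup>2 * y \<le> K\<^sup>2 * (of_int N * \<epsilon>)"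
      by (intro mult_left_mono) auto
    also have "\<dots> = (\<Sum>i<nat N. 1 * K\<^sup>2 * \<epsilon>)"
      using N by simp
    also have "\<dots> \<le> (\<Sum>i<nat N. (exp (T * L) + K * (T * L) powi k) ^ i * K\<^sup>2 * \<epsilon>)"
    proof (intro sum_mono mult_right_mono one_le_power)
      have "1 \<le> exp (T * L)" using T_pos L_pos by simp
      moreover have "0 \<le> K * (T * L) powi k"
        using K_ge \<epsilon> by (simp add: \<epsilon>_def \<tau>_def)
      ultimately show "1 \<le> exp (T * L) + K * (T * L) powi k" by linarith
    qed (use \<epsilon> in auto)
    also have "\<dots> = c k"
      by (simp add: c_def \<epsilon>_def \<tau>_def)
    finally show ?thesis .
  qed
  have Ky: "K * y < 0.27"
  proof (rule cubic_bound)
    have "K * y \<le> K\<^sup>2 * y"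
      using K_ge y by (intro mult_right_mono) (auto simp: power2_eq_square)
    with c_ge have le: "K * y \<le> c k" by (rule order_trans[rotated])
    have "0 \<le> K * y" using K_ge y by simp
    with le have c_nonneg: "0 \<le> c k" by (rule order_trans[rotated])
    \<comment> \<open>Putting the lower bounds \<open>K * y\<close> for \<open>c k\<close> and 1 for
      \<open>K\<close> into \<open>ck2\<close> leaves a cubic in \<open>K * y\<close> alone.\<close>
    have "(K * y)\<^sup>2 + K * y * (1 + K * y) * (1 + K * y) \<le> (c k)\<^sup>2 + K * y * (1 + c k) * (K + c k)"
      using le y K_ge c_nonneg by (intro add_mono power_mono mult_mono mult_nonneg_nonneg) auto
    also have "\<dots> = (c k)\<^sup>2 + \<delta> * K * (\<epsilon> / T) * (1 + c k) * (K + c k)"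
      using L_pos T_pos by (simp add: y_def \<Lambda>_def \<tau>_def)
    also have "\<dots> < 1 / 2"
      using ck2 by (simp only: \<delta>_def \<epsilon>_def \<tau>_def)
    finally show "(K * y)\<^sup>2 + K * y * (1 + K * y) * (1 + K * y) < 1 / 2" .
  qed
  have y_less: "y < 0.27"
  proof -
    have "1 * y \<le> K * y" using K_ge y by (intro mult_right_mono) auto
    with Ky show ?thesis by linarith
  qed
  let ?d = "2 * q ^ nat (N * k - 1)"
  show ?thesis
  proof (cases "M \<subseteq> {0}")
    \<comment> \<open>Without a nonzero initial point neither \<open>lam \<le> L\<close> nor
      \<open>q \<ge> 1\<close> is available, but then \<open>V = 0\<close> does everything.\<close>
    case True
    have "poly_fun_degree (\<lambda>x :: real ^ 'n. 0) \<le> ?d"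
      by (subst poly_fun_degree_le_iff) (auto intro: total_degree_le_zero)
    moreover have "sum_of_squares (\<lambda>x :: real ^ 'n. 0)"
      unfolding sum_of_squares_def by (intro exI[of _ 0]) auto
    ultimately show ?thesis
      using True f_zero
      by (intro exI[of _ "1::real"] exI[of _ "\<lambda>_. 0"]) (auto simp: subset_singleton_iff)
  next
    case False
    then obtain x0 where x0: "x0 \<in> M" "x0 \<noteq> 0" by blast
    obtain x where x: "x 0 = x0" "\<And>t. t \<ge> 0 \<Longrightarrow> (x has_vector_derivative f (x t)) (at t within {0..})"
      "\<And>t. t \<ge> 0 \<Longrightarrow> norm (x t) \<le> K * norm x0 * exp (- lam * t)"
      using decay x0 by blast
    \<comment> \<open>The Lipschitz constant is left free so that the rate comparison also excludes
      \<open>q = 0\<close>: then \<open>f\<close> is zero, and \<open>lam / 2\<close> is a Lipschitz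
      constant smaller than \<open>lam\<close>.\<close>
    have sol: "decaying_solution f L' K r lam x0 x" if "L' > 0" "L'-lipschitz_on (cball 0 (4 * K * r)) f" for L'
      by unfold_locales (use x x0 M_subset K_ge lam_pos f_zero that in auto)
    have lam_le: "lam \<le> L"
      using decaying_solution.decay_rate_le[OF sol[OF L_pos lipschitz] x0(2)] .
    have degree: "total_degree_le q (\<lambda>x. f x $ i)" for i
      using total_degree_le_vector_field_degree[OF f_poly] f_degree by simp
    have q: "q \<ge> 1"
    proof (rule ccontr)
      assume "\<not> q \<ge> 1"
      then have "q = 0" by simp
      then have "f x $ i = f 0 $ i" for x i
        using degree[of i] by (intro total_degree_le_0_const[of "\<lambda>x. f x $ i"]) simp
      then have "f x = 0" for x
        by (simp add: vec_eq_iff f_zero)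
      then have "(lam / 2)-lipschitz_on (cball 0 (4 * K * r)) f"
        using lam_pos by (simp add: lipschitz_on_def)
      then have "lam \<le> lam / 2"
        using decaying_solution.decay_rate_le[OF sol[of "lam / 2"] x0(2)] lam_pos by simp
      then show False using lam_pos by simp
    qed
    interpret decaying_polynomial_field f M q r lam K L
      by unfold_locales (fact f_poly degree q f_zero r_pos lam_pos K_ge L_pos M_subset decay lipschitz)+
    have "ln (2 * K\<^sup>2) = 2 * (lam * \<delta>)"
      using lam_pos by (simp add: \<delta>_def)
    also have "\<dots> \<le> 2 * \<Lambda>"
      using lam_le \<delta> by (simp add: \<Lambda>_def mult_right_mono)
    finally have ln_le: "ln (2 * K\<^sup>2) \<le> 2 * \<Lambda>" .
    have "2 / 3 \<le> ln (2 :: real)" by (rule ln2_ge_two_thirds)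
    also have "\<dots> \<le> ln (2 * K\<^sup>2)" using K2 K_ge by (subst ln_le_cancel_iff) auto
    finally have \<Lambda>_ge: "1 / 3 \<le> \<Lambda>" using ln_le by simp
    \<comment> \<open>For \<open>k \<le> 1\<close> the quotient \<open>\<epsilon> / \<tau>\<close>
      is at least 1, hence \<open>y \<ge> \<Lambda> \<ge> 1 / 3\<close>, above the bound
      0.27.\<close>
    have k: "k \<ge> 2"
    proof (rule ccontr)
      assume "\<not> k \<ge> 2"
      then have "\<tau> powi 1 \<le> \<tau> powi k"
        using \<tau> by (intro power_int_decreasing) auto
      then have "\<Lambda> * 1 \<le> y"
        unfolding y_def \<epsilon>_def using \<Lambda> \<tau> by (intro mult_left_mono) auto
      then show False using y_less \<Lambda>_ge by simp
    qed
    define J where "J = nat (N * k - 1)"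
    \<comment> \<open>This makes \<open>N * k - 1\<close> positive, so \<open>nat\<close> does not
      truncate.\<close>
    have "N * 2 \<le> N * k" using N k by (intro mult_left_mono) auto
    then have J: "int J = N * k - 1" using N by (simp add: J_def)
    have short: "sos_lyapunov (2 * q ^ J')"
      if "J' \<ge> 1" "\<Lambda> \<le> 1" "s = \<Lambda> ^ Suc J' / fact (Suc J')"
        "3.4144 * (K * s) + K\<^sup>2 * s\<^sup>2 + K * s\<^sup>2 < 1 / 2" for J' s
      using sos_lyapunov_short_horizon[of J' \<Lambda> s] that by (simp add: \<Lambda>_def \<delta>_def)
    \<comment> \<open>At the extreme values the sum is about 0.4976.\<close>
    have small: "3.4144 * a + b + b' < 1 / 2" if "a \<le> 0.135" "b \<le> 0.0183" "b' \<le> b" for a b b' :: real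
      using that by simp
    have "sos_lyapunov (2 * q ^ J)"
    proof (cases "5 * \<Lambda> \<le> real J")
      case True
      moreover have "J \<ge> 1"
        using True \<Lambda> by (cases J) auto
      ultimately show ?thesis
        using lam_le by (intro sos_lyapunov_long_horizon) (auto simp: \<Lambda>_def \<delta>_def)
    next
      case J_less: False
      show ?thesis
      proof (cases "N = 1 \<and> k = 2")
        case True
        then have J1: "J = 1" by (simp add: J_def)
        have \<Lambda>1: "\<Lambda> < \<tau>" using \<Lambda>_less True by simp
        \<comment> \<open>As \<open>N = 1\<close>, also \<open>\<Lambda> < \<tau>\<close>, so
          \<open>K * \<Lambda>\<^sup>2\<close> is below 0.27 and \<open>K * s\<close> is at most
          half of that.\<close>
        have "y = \<Lambda> * \<tau>"
          using True \<tau> by (simp add: y_def \<epsilon>_def power2_eq_square)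
        then have "K * \<Lambda>\<^sup>2 \<le> K * y"
          using \<Lambda>1 \<Lambda> K_ge by (simp add: power2_eq_square)
        define s where "s = \<Lambda>\<^sup>2 / 2"
        have s: "0 \<le> s" "K * s \<le> 0.135"
          using \<open>K * \<Lambda>\<^sup>2 \<le> K * y\<close> Ky by (auto simp: s_def)
        have "(K * s)\<^sup>2 \<le> 0.135\<^sup>2"
          using s K_ge by (intro power_mono) auto
        also have "\<dots> \<le> (0.0183 :: real)" by (simp add: power2_eq_square)
        finally have "(K * s)\<^sup>2 \<le> 0.0183" .
        moreover have "K\<^sup>2 * s\<^sup>2 = (K * s)\<^sup>2" by (rule power_mult_distrib[symmetric])
        moreover have "K * s\<^sup>2 \<le> (K * s)\<^sup>2"
          using K_ge mult_right_mono[of K "K\<^sup>2" "s\<^sup>2"] by (simp add: power2_eq_square mult_ac)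
        ultimately have "3.4144 * (K * s) + K\<^sup>2 * s\<^sup>2 + K * s\<^sup>2 < 1 / 2"
          using s(2) by (intro small) auto
        then show ?thesis
          unfolding J1 using \<Lambda>1 \<tau> by (intro short[of 1 s]) (auto simp: s_def power2_eq_square)
      next
        case False
        have "real J < 5 * \<Lambda>" using J_less by simp
        moreover have "real J = of_int (N * k) - 1"
          using arg_cong[OF J, of real_of_int] by simp
        ultimately have \<Lambda>_J: "of_int (N * k) < 5 * \<Lambda> + 1" by linarith
        have \<Lambda>34: "\<Lambda> \<le> 3 / 4" and J2: "J \<ge> 2"
        proof -
          show "J \<ge> 2"
          proof (cases "N = 1")
            case True
            then show ?thesis using False k J by simp
          next
            case N1: False
            then have "2 * 2 \<le> N * k" using N k by (intro mult_mono) auto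
            then show ?thesis using J by simp
          qed
          \<comment> \<open>If \<open>\<Lambda>\<close> were larger, \<open>N \<ge> 2\<close>, and
            comparing \<open>\<Lambda> < N / 2\<close> with \<open>N * k < 5 * \<Lambda> + 1\<close>
            forces \<open>k = 2\<close>. Then \<open>\<Lambda>\<^sup>2 < N * y < 0.27 * N\<close>,
            contradicting 3/4 for \<open>N = 2\<close> and
            \<open>\<Lambda> > (2 * N - 1) / 5\<close> for larger \<open>N\<close>.\<close>
          show "\<Lambda> \<le> 3 / 4"
          proof (rule ccontr)
            assume "\<not> \<Lambda> \<le> 3 / 4"
            then have gt: "3 / 4 < \<Lambda>" by simp
            have "of_int N * \<tau> < of_int N * (1 / 2)"
              using N \<tau> by (intro mult_strict_left_mono) auto
            then have \<Lambda>N: "\<Lambda> < of_int N / 2" using \<Lambda>_less by simp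
            then have N2: "N \<ge> 2"
              using gt by linarith
            have k2: "k = 2"
            proof (rule ccontr)
              assume "k \<noteq> 2"
              then have "N * 3 \<le> N * k" using N k by (intro mult_left_mono) auto
              then have "real_of_int N * 3 \<le> of_int (N * k)"
                by (metis of_int_le_iff of_int_mult of_int_numeral)
              then show False using \<Lambda>_J \<Lambda>N N2 by linarith
            qed
            have "\<Lambda> * \<Lambda> < \<Lambda> * (of_int N * \<tau>)"
              using \<Lambda>_less \<Lambda> by (rule mult_strict_left_mono)
            also have "\<dots> = of_int N * y"
              using k2 \<tau> by (simp add: y_def \<epsilon>_def power2_eq_square)
            also have "\<dots> \<le> of_int N * (27 / 100)"
              using y_less N by (intro mult_left_mono) auto
            finally have sq: "\<Lambda> * \<Lambda> < of_int N * (27 / 100)" .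
            show False
            proof (cases "N = 2")
              case True
              have "3 / 4 * (3 / 4) \<le> \<Lambda> * \<Lambda>" using gt by (intro mult_mono) auto
              then show False using sq True by simp
            next
              case N3: False
              let ?n = "real_of_int N"
              have n: "?n \<ge> 3" using N3 N2 by simp
              have "(2 * ?n - 1) / 5 < \<Lambda>" using \<Lambda>_J k2 by simp
              then have "(2 * ?n - 1) / 5 * ((2 * ?n - 1) / 5) \<le> \<Lambda> * \<Lambda>"
                using n by (intro mult_mono) auto
              moreover have "3 * ?n \<le> ?n * ?n" using n by (intro mult_right_mono) auto
              moreover have "(2 * ?n - 1) / 5 * ((2 * ?n - 1) / 5) = (4 * (?n * ?n) - 4 * ?n + 1) / 25"
                by (simp add: field_simps)
              moreover have False
                if "(4 * a - 4 * ?n + 1) / 25 \<le> b" "3 * ?n \<le> a" "b < ?n * (27 / 100)" for a b :: real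
                using that n by (simp add: field_simps)
              ultimately show False using sq by metis
            qed
          qed
        qed
        \<comment> \<open>Since \<open>lam \<le> L\<close>, a short horizon also limits the
          overshoot: \<open>2 * K\<^sup>2 \<le> exp (3 / 2) \<le> 4.5\<close>.\<close>
        have "ln (2 * K\<^sup>2) \<le> 3 / 2" using ln_le \<Lambda>34 by simp
        then have "exp (ln (2 * K\<^sup>2)) \<le> exp (3 / 2)" by (simp only: exp_le_cancel_iff)
        then have "2 * K\<^sup>2 \<le> exp (3 / 2)" using K_ge by simp
        moreover have "exp (3 / 2 :: real) \<le> 4.5"
        proof (rule power2_le_imp_le)
          have "(exp (3 / 2 :: real))\<^sup>2 = exp 1 * exp 1 * exp 1"
            by (simp flip: exp_double exp_add)
          also have "\<dots> \<le> (2.72 * 2.72 * 2.72 :: real)"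
            using e_less_272 by (intro mult_mono) auto
          finally show "(exp (3 / 2 :: real))\<^sup>2 \<le> 4.5\<^sup>2"
            by (simp add: power2_eq_square)
        qed simp
        ultimately have "2 * K\<^sup>2 \<le> 4.5" by (rule order_trans)
        then have "K\<^sup>2 \<le> 1.5\<^sup>2" by (simp add: power2_eq_square)
        then have K32: "K \<le> 1.5" by (rule power2_le_imp_le) simp
        define s where "s = \<Lambda> ^ Suc 2 / fact (Suc 2)"
        have "\<Lambda> ^ 3 \<le> (3 / 4) ^ 3"
          using \<Lambda>34 \<Lambda> by (intro power_mono) auto
        then have s: "0 \<le> s" "s \<le> 0.0704"
          using \<Lambda> by (auto simp: s_def fact_numeral power3_eq_cube numeral_eq_Suc)
        have Ks: "K * s \<le> 1.5 * 0.0704"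
          using K32 s K_ge by (intro mult_mono) auto
        then have "(K * s)\<^sup>2 \<le> (1.5 * 0.0704)\<^sup>2"
          using s K_ge by (intro power_mono) auto
        also have "\<dots> \<le> (0.0112 :: real)" by (simp add: power2_eq_square)
        finally have "(K * s)\<^sup>2 \<le> 0.0112" .
        moreover have "K\<^sup>2 * s\<^sup>2 = (K * s)\<^sup>2" by (rule power_mult_distrib[symmetric])
        moreover have "K * s\<^sup>2 \<le> (K * s)\<^sup>2"
          using K_ge mult_right_mono[of K "K\<^sup>2" "s\<^sup>2"] by (simp add: power2_eq_square mult_ac)
        ultimately have "3.4144 * (K * s) + K\<^sup>2 * s\<^sup>2 + K * s\<^sup>2 < 1 / 2"
          using Ks by (intro small) auto
        \<comment> \<open>Two iterations already suffice, and \<open>J \<ge> 2\<close> with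
          \<open>q \<ge> 1\<close> leaves room in the degree bound.\<close>
        then have "sos_lyapunov (2 * q ^ 2)"
          using \<Lambda>34 by (intro short[of 2 s]) (auto simp: s_def)
        then show ?thesis
          by (rule sos_lyapunov_mono) (use q J2 in \<open>simp add: power_increasing\<close>)
      qed
    qed
    then show ?thesis
      unfolding sos_lyapunov_def J_def .
  qed
qed

end
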